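(* Suppose the objective $F$ and the stochastic gradients satisfy the lower boundedness, joint $(\mathcal L_0,\mathcal L_1,q)$-smoothness and layer-wise variance assumptions stated in the context. Let $\{X_t\}_{t=1}^{T+1}$ be generated by layer-wise Muon (see context) with $\beta_1\in[0,1)$, $\beta_2\in[0,1]$, $\gamma>0$, where the orthogonalization routine is the $J$-step Frobenius-normalized Newton--Schulz map described in the context, whose scalar map $\phi_J$ satisfies $$\ell_J:=\inf_{0<s\le1}\frac{\phi_J(s)}{s}>0,\qquad u_J:=\sup_{0<s\le1}\frac{\phi_J(s)}{s}<\infty .$$ Define $\delta=1-\beta_1$, $D=F(X_1)-F^*$, $S_{\mathsf F}=\sum_{l=1}^L\sigma_{(l)}$, $G_{\mathsf F}=\sum_{l=1}^L\|\nabla_{(l)}F(X_1)\|_{\mathsf F}$, $v_\beta=\sqrt{\delta}+\sqrt{2\beta_1(1-\beta_1\beta_2)(1-\beta_2)}$, $\hat{\mathcal L}=\mathcal L_0+(1-q)\mathcal L_1$, and $$\Delta^{\mathsf F}_{\gamma,\beta_1}:=\ell_J-\frac{\gamma L u_J^2 q\mathcal L_1}{2}-\frac{\gamma L u_J(\ell_J+u_J)q\mathcal L_1}{\delta}.$$ Then $$\begin{aligned} \Delta^{\mathsf F}_{\gamma,\beta_1}\,\frac1T\sum_{t=1}^T\sum_{l=1}^L\mathbb E\|\nabla_{(l)}F(X_t)\|_{\mathsf F} \le{}&\frac{D}{\gamma T}+\frac{\beta_2(\ell_J+u_J)G_{\mathsf F}}{T\delta}+(\ell_J+u_J)v_\beta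 S_{\mathsf F}\\ &+\frac{\gamma\beta_2 L u_J(\ell_J+u_J)\hat{\mathcal L}}{\delta}+\frac{\gamma L u_J^2\hat{\mathcal L}}{2}. \end{aligned}$$
   Context: Parameter space: $\mathcal S=\mathbb R^{n_1\times m_1}\times\cdots\times\mathbb R^{n_L\times m_L}$; $X=(X^{(1)},\dots,X^{(L)})$, with $\|X\|_{\mathsf F}^2=\sum_{l=1}^L\|X^{(l)}\|_{\mathsf F}^2$ ($\|\cdot\|_{\mathsf F}$ is the Frobenius norm). The objective is $F(X)=\mathbb E_\xi[f(X;\xi)]$; $\nabla_{(l)}$ denotes the gradient block with respect to $X^{(l)}$. Assumptions. (Lower boundedness) There is $F^*>-\infty$ with $F(X)\ge F^*$ for all $X\in\mathcal S$. (Joint smoothness) $F:\mathcal S\to\mathbb R$ is differentiable and, for some $\mathcal L_0>0$, $\mathcal L_1\ge0$, $q\in[0,1]$ and all $X,Y\in\mathcal S$, $\|\nabla F(X)-\nabla F(Y)\|_{\mathsf F}\le(\mathcal L_0+\mathcal L_1\|\nabla F(X)\|_{\mathsf F}^q)\|X-Y\|_{\mathsf F}$; for $q=0$ the power is interpreted as $1$, including at a zero gradient. (Layer-wise variance) For each $l$ there is $\sigma_{(l)}\ge0$ such that for all $X\in\mathcal S$: $\mathbb E_\xi[\nabla_{(l)}f(X;\xi)]=\nabla_{(l)}F(X)$ and $\mathbb E_\xi\|\nabla_{(l)}f(X;\xi)-\nabla_{(l)}F(X)\|_{\mathsf F}^2\le\sigma_{(l)}^2$. At iteration $t$, the sample $\xi_t$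 is independent of the past $\mathcal F_{t-1}$ (the $\sigma$-field of the history before step $t$, with respect to which $X_t$ is measurable), so the same statements hold conditionally on $\mathcal F_{t-1}$ at $X=X_t$. Noise in different layers need not be independent. Algorithm (layer-wise Muon). $X_1\in\mathcal S$ is a given deterministic point and $M_0^{(l)}=0$. For $t=1,\dots,T$ and each $l=1,\dots,L$: $G_t^{(l)}=\nabla_{(l)}f(X_t;\xi_t)$; $M_t^{(l)}=\beta_1M_{t-1}^{(l)}+(1-\beta_1)G_t^{(l)}$; $N_t^{(l)}=\beta_2M_t^{(l)}+(1-\beta_2)G_t^{(l)}$; $O_t^{(l)}=$ orthogonalization routine applied to $N_t^{(l)}$; $X_{t+1}^{(l)}=X_t^{(l)}-\gamma O_t^{(l)}$. All gradient blocks at step $t$ are evaluated at the same $X_t$. Newton--Schulz routine. Fix $J\ge1$ and real coefficients $(a_j,b_j,c_j)_{j=1}^J$. For a matrix $N\ne0$ put $Z_0=N/\|N\|_{\mathsf F}$, $Z_j=a_jZ_{j-1}+b_j(Z_{j-1}Z_{j-1}^\top)Z_{j-1}+c_j(Z_{j-1}Z_{j-1}^\top)^2Z_{j-1}$ for $j=1,\dots,J$, and output $O=Z_J$; for $N=0$ output $O=0$. The associated scalar map is $\phi_J=p_J\circ\cdots\circ p_1$ with $p_j(s)=a_js+b_js^3+c_js^5$. Exact arithmetic is assumed. *)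

theory Defs
  imports "HOL-Probability.Probability"
begin

text \<open>
  The parameter space, the product over the layers \<open>l\<close> of the spaces of \<open>n\<^sub>l\<close> by \<open>m\<^sub>l\<close>
  matrices, is a linear subspace of \<^typ>\<open>real ^ 'c ^ 'r ^ 'l\<close>: layer \<open>l\<close> uses only the rows
  in \<open>R l\<close> and the columns in \<open>C l\<close>, so \<open>n\<^sub>l = card (R l)\<close> and \<open>m\<^sub>l = card (C l)\<close>, and all
  other entries are zero. Zero padding is compatible with transposition, matrix product, inner
  product and norm. The norm of \<^typ>\<open>real ^ 'c ^ 'r\<close>, and that of \<^typ>\<open>real ^ 'c ^ 'r ^ 'l\<close>,
  is the Euclidean norm of all the entries, that is, the Frobenius norm; the number of layers
  is \<open>CARD('l)\<close>.
\<close>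

definition layer_space ::
  "('l::finite \<Rightarrow> 'r::finite set) \<Rightarrow> ('l \<Rightarrow> 'c::finite set) \<Rightarrow> (real ^ 'c ^ 'r ^ 'l) set" where
  "layer_space R C = {X. \<forall>l i j. X $ l $ i $ j \<noteq> 0 \<longrightarrow> i \<in> R l \<and> j \<in> C l}"

text \<open>
  Derivatives are taken within the subspace, and the representing vector is required to lie in
  the subspace, which makes it unique.
\<close>

definition grad_on :: "'a::real_inner set \<Rightarrow> ('a \<Rightarrow> real) \<Rightarrow> 'a \<Rightarrow> 'a" where
  "grad_on S g X = (THE G. G \<in> S \<and> (g has_derivative (\<lambda>H. G \<bullet> H)) (at X within S))"

text \<open>The conditional implements the convention \<open>x\<^sup>0 = 1\<close> at \<open>x = 0\<close>, since \<open>0 powr 0 = 0\<close>.\<close>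

definition joint_smooth_on ::
  "'a::real_inner set \<Rightarrow> ('a \<Rightarrow> real) \<Rightarrow> real \<Rightarrow> real \<Rightarrow> real \<Rightarrow> bool" where
  "joint_smooth_on S F L0 L1 q \<longleftrightarrow>
     F differentiable_on S \<and>
     (\<forall>X\<in>S. \<forall>Y\<in>S. norm (grad_on S F X - grad_on S F Y)
        \<le> (L0 + L1 * (if q = 0 then 1 else norm (grad_on S F X) powr q)) * norm (X - Y))"

definition expected_objective :: "'z measure \<Rightarrow> ('a \<Rightarrow> 'z \<Rightarrow> real) \<Rightarrow> 'a \<Rightarrow> real" where
  "expected_objective P f X = (LINT z|P. f X z)"

definition layerwise_variance ::
  "(real ^ 'c::finite ^ 'r::finite ^ 'l::finite) set \<Rightarrow> 'z measure \<Rightarrow>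
   (real ^ 'c ^ 'r ^ 'l \<Rightarrow> 'z \<Rightarrow> real) \<Rightarrow> ('l \<Rightarrow> real) \<Rightarrow> bool" where
  "layerwise_variance S P f \<sigma> \<longleftrightarrow>
     (\<forall>l. \<sigma> l \<ge> 0 \<and> (\<forall>X\<in>S.
        integrable P (\<lambda>z. grad_on S (\<lambda>Y. f Y z) X $ l) \<and>
        (LINT z|P. grad_on S (\<lambda>Y. f Y z) X $ l) = grad_on S (expected_objective P f) X $ l \<and>
        integrable P (\<lambda>z. (norm (grad_on S (\<lambda>Y. f Y z) X $ l
                                 - grad_on S (expected_objective P f) X $ l))\<^sup>2) \<and>
        (LINT z|P. (norm (grad_on S (\<lambda>Y. f Y z) X $ l
                          - grad_on S (expected_objective P f) X $ l))\<^sup>2) \<le> (\<sigma> l)\<^sup>2))"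

primrec ns_iter ::
  "(nat \<Rightarrow> real) \<Rightarrow> (nat \<Rightarrow> real) \<Rightarrow> (nat \<Rightarrow> real) \<Rightarrow> real ^ 'c ^ 'r \<Rightarrow> nat \<Rightarrow> real ^ 'c ^ 'r" where
  "ns_iter a b c Z0 0 = Z0"
| "ns_iter a b c Z0 (Suc j) =
     (let Z = ns_iter a b c Z0 j; A = Z ** transpose Z
      in a (Suc j) *\<^sub>R Z + b (Suc j) *\<^sub>R (A ** Z) + c (Suc j) *\<^sub>R ((A ** A) ** Z))"

definition newton_schulz ::
  "(nat \<Rightarrow> real) \<Rightarrow> (nat \<Rightarrow> real) \<Rightarrow> (nat \<Rightarrow> real) \<Rightarrow> nat \<Rightarrow> real ^ 'c ^ 'r \<Rightarrow> real ^ 'c ^ 'r" where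
  "newton_schulz a b c J N = (if N = 0 then 0 else ns_iter a b c (N /\<^sub>R norm N) J)"

primrec ns_scalar ::
  "(nat \<Rightarrow> real) \<Rightarrow> (nat \<Rightarrow> real) \<Rightarrow> (nat \<Rightarrow> real) \<Rightarrow> nat \<Rightarrow> real \<Rightarrow> real" where
  "ns_scalar a b c 0 s = s"
| "ns_scalar a b c (Suc j) s =
     (let x = ns_scalar a b c j s in a (Suc j) * x + b (Suc j) * x ^ 3 + c (Suc j) * x ^ 5)"

definition ns_lower :: "(nat \<Rightarrow> real) \<Rightarrow> (nat \<Rightarrow> real) \<Rightarrow> (nat \<Rightarrow> real) \<Rightarrow> nat \<Rightarrow> real" where
  "ns_lower a b c J = (INF s\<in>{0<..1}. ns_scalar a b c J s / s)"

definition ns_upper :: "(nat \<Rightarrow> real) \<Rightarrow> (nat \<Rightarrow> real) \<Rightarrow> (nat \<Rightarrow> real) \<Rightarrow> nat \<Rightarrow> real" where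
  "ns_upper a b c J = (SUP s\<in>{0<..1}. ns_scalar a b c J s / s)"

text \<open>The infimum and supremum above are always those of a bounded nonempty set of reals.\<close>

lemma ns_scalar_bound: "\<exists>K\<ge>0. \<forall>s\<in>{0<..1}. \<bar>ns_scalar a b c j s\<bar> \<le> K * s"
proof (induction j)
  case 0
  show ?case by (intro exI[of _ 1]) auto
next
  case (Suc j)
  then obtain K where K: "K \<ge> 0" "\<And>s. s \<in> {0<..1} \<Longrightarrow> \<bar>ns_scalar a b c j s\<bar> \<le> K * s"
    by blast
  define B where "B = \<bar>a (Suc j)\<bar> + \<bar>b (Suc j)\<bar> * K ^ 2 + \<bar>c (Suc j)\<bar> * K ^ 4"
  have B0: "B \<ge> 0" by (simp add: B_def K(1))
  have "\<bar>ns_scalar a b c (Suc j) s\<bar> \<le> (B * K) * s" if s: "s \<in> {0<..1}" for s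
  proof -
    define x where "x = ns_scalar a b c j s"
    have x1: "\<bar>x\<bar> \<le> K * s" using K(2)[OF s] by (simp add: x_def)
    have "K * s \<le> K * 1" using s K(1) by (intro mult_left_mono) auto
    then have x2: "\<bar>x\<bar> \<le> K" using x1 by linarith
    have "\<bar>a (Suc j) * x + b (Suc j) * x ^ 3 + c (Suc j) * x ^ 5\<bar>
        \<le> \<bar>a (Suc j) * x\<bar> + \<bar>b (Suc j) * x ^ 3\<bar> + \<bar>c (Suc j) * x ^ 5\<bar>"
      by linarith
    also have "\<dots> = (\<bar>a (Suc j)\<bar> + \<bar>b (Suc j)\<bar> * \<bar>x\<bar> ^ 2 + \<bar>c (Suc j)\<bar> * \<bar>x\<bar> ^ 4) * \<bar>x\<bar>"
      unfolding abs_mult power_abs by (simp add: algebra_simps eval_nat_numeral abs_mult)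
    also have "\<dots> \<le> B * \<bar>x\<bar>"
      unfolding B_def using x2 K(1)
      by (intro mult_right_mono add_mono mult_left_mono power_mono) auto
    also have "\<dots> \<le> B * (K * s)" using x1 B0 by (intro mult_left_mono)
    finally show ?thesis by (simp add: x_def Let_def mult.assoc)
  qed
  then show ?case using B0 K(1) by (intro exI[of _ "B * K"]) auto
qed

lemma ns_ratio_bdd:
  "bdd_above ((\<lambda>s. ns_scalar a b c J s / s) ` {0<..1})"
  "bdd_below ((\<lambda>s. ns_scalar a b c J s / s) ` {0<..1})"
proof -
  obtain K where K: "\<And>s. s \<in> {0<..1} \<Longrightarrow> \<bar>ns_scalar a b c J s\<bar> \<le> K * s"
    using ns_scalar_bound by blast
  have "\<bar>ns_scalar a b c J s / s\<bar> \<le> K" if "s \<in> {0<..1}" for s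
    using K[OF that] that by (simp add: abs_divide pos_divide_le_eq)
  then have *: "ns_scalar a b c J s / s \<le> K \<and> - K \<le> ns_scalar a b c J s / s"
    if "s \<in> {0<..1}" for s using that by (meson abs_le_iff minus_le_iff)
  show "bdd_above ((\<lambda>s. ns_scalar a b c J s / s) ` {0<..1})"
    using * by (intro bdd_aboveI2[of _ _ K]) auto
  show "bdd_below ((\<lambda>s. ns_scalar a b c J s / s) ` {0<..1})"
    using * by (intro bdd_belowI2[of _ "- K"]) auto
qed

text \<open>
  One trajectory of the algorithm: \<open>z t\<close> is the sample used at step \<open>t\<close>, \<open>X t\<close> the iterate for
  \<open>1 \<le> t \<le> T + 1\<close>, and \<open>Mom t\<close> the momentum for \<open>0 \<le> t \<le> T\<close>.
\<close>

definition layerwise_muon ::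
  "(real ^ 'c::finite ^ 'r::finite ^ 'l::finite) set \<Rightarrow> (real ^ 'c ^ 'r ^ 'l \<Rightarrow> 'z \<Rightarrow> real) \<Rightarrow>
   (real ^ 'c ^ 'r \<Rightarrow> real ^ 'c ^ 'r) \<Rightarrow> real \<Rightarrow> real \<Rightarrow> real \<Rightarrow> nat \<Rightarrow> real ^ 'c ^ 'r ^ 'l \<Rightarrow>
   (nat \<Rightarrow> 'z) \<Rightarrow> (nat \<Rightarrow> real ^ 'c ^ 'r ^ 'l) \<Rightarrow> (nat \<Rightarrow> real ^ 'c ^ 'r ^ 'l) \<Rightarrow> bool" where
  "layerwise_muon S f orth \<beta>1 \<beta>2 \<gamma> T Xinit z X Mom \<longleftrightarrow>
     X 1 = Xinit \<and> (\<forall>l. Mom 0 $ l = 0) \<and>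
     (\<forall>t\<in>{1..T}. \<forall>l.
        let G = grad_on S (\<lambda>Y. f Y (z t)) (X t) $ l;
            N = \<beta>2 *\<^sub>R (Mom t $ l) + (1 - \<beta>2) *\<^sub>R G
        in Mom t $ l = \<beta>1 *\<^sub>R (Mom (t - 1) $ l) + (1 - \<beta>1) *\<^sub>R G \<and>
           X (t + 1) $ l = X t $ l - \<gamma> *\<^sub>R orth N)"

text \<open>
  The \<open>\<sigma>\<close>-field generated by the samples used before step \<open>t\<close>. As the initial point is
  deterministic, the iterate \<open>X t\<close> is a function of these samples.
\<close>

definition sample_events :: "'w measure \<Rightarrow> 'z measure \<Rightarrow> ('w \<Rightarrow> 'z) \<Rightarrow> 'w set set" where
  "sample_events \<Omega> P \<zeta> = {\<zeta> -` A \<inter> space \<Omega> | A. A \<in> sets P}"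

definition history :: "'w measure \<Rightarrow> 'z measure \<Rightarrow> (nat \<Rightarrow> 'w \<Rightarrow> 'z) \<Rightarrow> nat \<Rightarrow> 'w set set" where
  "history \<Omega> P \<xi> t = sigma_sets (space \<Omega>) (\<Union>s\<in>{1..<t}. sample_events \<Omega> P (\<xi> s))"

end

theory Submission
  imports Defs
begin

text \<open>
  On an orthonormal eigenbasis of \<open>Z\<^sub>0\<^sup>T Z\<^sub>0\<close> the Newton--Schulz iteration acts by the scalars
  \<open>\<phi>\<^sub>J(s)/s\<close>, so its output \<open>O\<close> on \<open>N\<close> satisfies \<open>\<langle>N, O\<rangle> \<ge> \<ell>\<^sub>J \<parallel>N\<parallel>\<close> and \<open>\<parallel>O\<parallel> \<le> u\<^sub>J\<close>.
  Hence \<open>\<langle>\<nabla>F, O\<rangle> \<ge> \<ell>\<^sub>J \<parallel>\<nabla>F\<parallel> - (\<ell>\<^sub>J + u\<^sub>J) \<parallel>N - \<nabla>F\<parallel>\<close> in each layer, which enters the descent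
  lemma; Young's inequality makes the local Lipschitz constant affine in \<open>\<parallel>\<nabla>F\<parallel>\<close>. The error
  \<open>N - \<nabla>F\<close> is the sum of a bias, bounded pathwise because steps have length \<open>O(\<gamma>)\<close>, and a weighted
  sum of the gradient noises, which are orthogonal in \<open>L\<^sup>2\<close> because every sample is independent of the
  past. The descent inequality is telescoped along each trajectory, so that only gradient and
  noise norms have to be integrated.
\<close>

subsection \<open>Spectral analysis of the Newton--Schulz map\<close>

text \<open>The output \<open>orth N\<close> need not be close to an orthogonal factor of
  \<open>N\<close>, and nothing is used about how it varies with \<open>N\<close>; the descent
  argument sees it only through its pairing with \<open>N\<close> and its norm. The local Lipschitz
  constant contains the gradient norm itself, for which there is no bound uniform in
  \<open>T\<close>. That part is carried through the descent step and through the sum of the biases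
  and then moved to the left side, where it becomes the two negative terms of \<Delta>. Each step
  contracts the bias by \<open>\<beta>1\<close>, so its sum costs a factor
  \<open>1 / \<delta>\<close>. The variance assumption concerns fixed points of \<open>S\<close>,
  while the algorithm evaluates the stochastic gradient at a random point that depends on earlier
  samples. Passing from one to the other takes the product law of past and sample together with
  Fubini, hence joint measurability of the stochastic gradient in point and sample. This is not
  assumed; it is derived from measurability of \<open>f\<close> in the sample and differentiability
  in the point.\<close>

lemma self_adjoint_max_eigenvector:
  fixes f :: "'a::euclidean_space \<Rightarrow> 'a"
  assumes f: "linear f" and sa: "\<And>x y. f x \<bullet> y = x \<bullet> f y"
    and W: "subspace W" and inv: "f ` W \<subseteq> W" and nz: "W \<noteq> {0}"
  obtains v k where "v \<in> W" "norm v = 1" "f v = k *\<^sub>R v"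
proof -
  define K where "K = sphere 0 1 \<inter> W"
  have "compact K"
    unfolding K_def by (simp add: compact_Int_closed closed_subspace W)
  moreover obtain w where w: "w \<in> W" "w \<noteq> 0"
    using nz W subspace_0 by blast
  then have "w /\<^sub>R norm w \<in> K"
    unfolding K_def using W by (auto simp: subspace_scale)
  then have "K \<noteq> {}" by blast
  moreover have "continuous_on K (\<lambda>x. x \<bullet> f x)"
    by (intro continuous_intros linear_continuous_on linear_conv_bounded_linear[THEN iffD1] f)
  ultimately obtain v where v: "v \<in> K" and max: "\<And>y. y \<in> K \<Longrightarrow> y \<bullet> f y \<le> v \<bullet> f v"
    using continuous_attains_sup[of K "\<lambda>x. x \<bullet> f x"] by blast
  define k where "k = v \<bullet> f v"
  have vW: "v \<in> W" and nv: "norm v = 1" and vv: "v \<bullet> v = 1"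
    using v by (auto simp: K_def dot_square_norm)
  have Q: "0 \<le> k * (x \<bullet> x) - x \<bullet> f x" if "x \<in> W" for x
  proof (cases "x = 0")
    case True
    then show ?thesis using f by simp
  next
    case False
    have "x /\<^sub>R norm x \<in> K"
      unfolding K_def using W that False by (auto simp: subspace_scale)
    from max[OF this] have "(x \<bullet> f x) / (norm x)^2 \<le> k"
      using f by (simp add: linear_scale k_def power2_eq_square divide_inverse mult_ac)
    then show ?thesis
      using False by (simp add: divide_le_eq dot_square_norm)
  qed
  \<comment> \<open>The residual of the eigenvalue equation serves as the direction of perturbation.
    The form \<open>k * (x \<bullet> x) - x \<bullet> f x\<close> is nonnegative on \<open>W\<close>
    and zero at \<open>v\<close>, and its derivative at \<open>v\<close> along \<open>w\<close> is
    twice \<open>w \<bullet> w\<close>; minimality forces this to vanish.\<close>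
  define w where "w = k *\<^sub>R v - f v"
  have wW: "w \<in> W"
    unfolding w_def using W vW inv by (intro subspace_diff subspace_scale) auto
  define Qw where "Qw = k * (w \<bullet> w) - w \<bullet> f w"
  have quad: "0 \<le> 2 * t * (w \<bullet> w) + t\<^sup>2 * Qw" for t
  proof -
    have "v + t *\<^sub>R w \<in> W" using W vW wW by (simp add: subspace_add subspace_scale)
    from Q[OF this] have "0 \<le> k * ((v + t *\<^sub>R w) \<bullet> (v + t *\<^sub>R w)) - (v + t *\<^sub>R w) \<bullet> f (v + t *\<^sub>R w)" .
    also have "\<dots> = (k * (v \<bullet> v) - v \<bullet> f v) + t * (2 * (k * (v \<bullet> w)) - w \<bullet> f v - v \<bullet> f w) + t\<^sup>2 * Qw"
      unfolding Qw_def using f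
      by (simp add: linear_add linear_scale inner_add inner_commute algebra_simps power2_eq_square)
    also have "v \<bullet> f w = w \<bullet> f v"
      using sa[of v w] by (simp add: inner_commute)
    also have "2 * (k * (v \<bullet> w)) - w \<bullet> f v - w \<bullet> f v = 2 * (w \<bullet> w)"
      by (simp add: w_def inner_diff inner_commute algebra_simps)
    finally show ?thesis using vv by (simp add: k_def algebra_simps)
  qed
  have "w \<bullet> w = 0"
  proof (rule ccontr)
    assume "w \<bullet> w \<noteq> 0"
    then have pos: "w \<bullet> w > 0" by (simp add: less_le)
    \<comment> \<open>A negative value, small enough that the quadratic term cannot outweigh the
      linear one whatever the sign of \<open>Qw\<close>.\<close>
    define t where "t = - (w \<bullet> w) / (\<bar>Qw\<bar> + 1)"
    have "t < 0" using pos by (simp add: t_def field_simps)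
    have "\<bar>t\<bar> * (\<bar>Qw\<bar> + 1) = w \<bullet> w"
      using pos by (simp add: t_def abs_divide)
    then have "\<bar>t\<bar> * \<bar>Qw\<bar> \<le> w \<bullet> w" by (simp add: algebra_simps)
    then have "t * Qw \<ge> - (w \<bullet> w)" by (metis abs_mult abs_le_iff minus_le_iff)
    then have "2 * (w \<bullet> w) + t * Qw > 0" using pos by linarith
    then have "t * (2 * (w \<bullet> w) + t * Qw) < 0"
      using \<open>t < 0\<close> by (simp add: mult_neg_pos)
    then show False using quad[of t] by (simp add: algebra_simps power2_eq_square)
  qed
  then have "f v = k *\<^sub>R v" by (simp add: w_def)
  then show thesis using that vW nv by blast
qed

text \<open>Splitting off one eigenvector leaves its orthogonal complement in \<open>W\<close>,
  which is again invariant because \<open>f\<close> is self-adjoint. The general invariant subspace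
  \<open>W\<close> is there for this induction on the dimension; only the whole space is needed
  later.\<close>

lemma self_adjoint_orthonormal_eigenbasis:
  fixes f :: "'a::euclidean_space \<Rightarrow> 'a"
  assumes f: "linear f" and sa: "\<And>x y. f x \<bullet> y = x \<bullet> f y"
    and W: "subspace W" and inv: "f ` W \<subseteq> W"
  obtains B where "finite B" "pairwise orthogonal B" "\<And>v. v \<in> B \<Longrightarrow> norm v = 1" "span B = W"
    "\<And>v. v \<in> B \<Longrightarrow> \<exists>k. f v = k *\<^sub>R v"
proof -
  have "\<exists>B. finite B \<and> pairwise orthogonal B \<and> (\<forall>v\<in>B. norm v = 1) \<and> span B = W \<and>
          (\<forall>v\<in>B. \<exists>k. f v = k *\<^sub>R v)"
    using W inv
  proof (induction "dim W" arbitrary: W rule: less_induct)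
    case less
    show ?case
    proof (cases "W = {0}")
      case True
      then show ?thesis by (intro exI[of _ "{}"]) auto
    next
      case False
      obtain v k where v: "v \<in> W" "norm v = 1" "f v = k *\<^sub>R v"
        using self_adjoint_max_eigenvector[OF f sa less.prems False] by blast
      have vv: "v \<bullet> v = 1" using v(2) by (simp add: dot_square_norm)
      define W' where "W' = {x \<in> W. v \<bullet> x = 0}"
      have W': "subspace W'"
        unfolding W'_def subspace_def using less.prems(1)
        by (auto simp: subspace_0 subspace_add subspace_scale inner_add)
      have "v \<notin> W'" using vv by (simp add: W'_def)
      moreover have "W' \<subseteq> W" by (auto simp: W'_def)
      ultimately have "W' \<subset> W" using v(1) by blast
      then have dim: "dim W' < dim W"
        using W' less.prems(1) by (metis dim_psubset span_eq_iff)
      have inv': "f ` W' \<subseteq> W'"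
        using less.prems(2) by (auto simp: W'_def v(3) sa[of v, symmetric])
      obtain B where B: "finite B" "pairwise orthogonal B" "\<forall>v\<in>B. norm v = 1" "span B = W'"
          "\<forall>v\<in>B. \<exists>k. f v = k *\<^sub>R v"
        using less.hyps[OF dim W' inv'] by blast
      have BW: "B \<subseteq> W'" using B(4) span_superset by blast
      have "span (insert v B) = W"
      proof
        show "span (insert v B) \<subseteq> W"
          using BW v(1) less.prems(1) by (intro span_minimal) (auto simp: W'_def)
        show "W \<subseteq> span (insert v B)"
        proof
          fix x assume x: "x \<in> W"
          have "x - (v \<bullet> x) *\<^sub>R v \<in> W'"
            unfolding W'_def using x v(1) vv less.prems(1)
            by (auto simp: subspace_diff subspace_scale inner_diff)
          then show "x \<in> span (insert v B)"
            unfolding span_breakdown_eq B(4) by blast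
        qed
      qed
      moreover have "pairwise orthogonal (insert v B)"
        using B(2) BW by (auto simp: pairwise_insert W'_def orthogonal_def inner_commute)
      ultimately show ?thesis
        using B v by (intro exI[of _ "insert v B"]) auto
    qed
  qed
  then show thesis using that by blast
qed

lemma orthonormal_basis_inner:
  fixes x y :: "'a::euclidean_space"
  assumes "finite B" "pairwise orthogonal B" "\<And>v. v \<in> B \<Longrightarrow> norm v = 1" "span B = UNIV"
  shows "x \<bullet> y = (\<Sum>v\<in>B. (x \<bullet> v) * (y \<bullet> v))"
proof -
  have "(\<Sum>v\<in>B. (x \<bullet> v) *\<^sub>R v) = x"
    using orthonormal_basis_expand[OF assms(2,3) _ assms(1)] assms(4) by auto
  then have "x \<bullet> y = (\<Sum>v\<in>B. (x \<bullet> v) *\<^sub>R v) \<bullet> y" by simp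
  also have "\<dots> = (\<Sum>v\<in>B. (x \<bullet> v) * (y \<bullet> v))"
    by (simp add: inner_sum_left inner_commute[of y])
  finally show ?thesis .
qed

text \<open>The Frobenius inner product is the trace of \<open>transpose M ** N\<close>, which every
  orthonormal basis computes. In an eigenbasis of the Gram matrix it reduces pairings and norms of
  the iterates to sums of scalars.\<close>

lemma frobenius_inner_orthonormal_basis:
  fixes M N :: "real ^ 'c ^ 'r"
  assumes "finite B" "pairwise orthogonal B" "\<And>v. v \<in> B \<Longrightarrow> norm v = 1" "span B = UNIV"
  shows "M \<bullet> N = (\<Sum>v\<in>B. (M *v v) \<bullet> (N *v v))"
proof -
  have "M \<bullet> N = (\<Sum>i\<in>UNIV. M $ i \<bullet> N $ i)" by (simp add: inner_vec_def)
  also have "\<dots> = (\<Sum>i\<in>UNIV. \<Sum>v\<in>B. (M $ i \<bullet> v) * (N $ i \<bullet> v))"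
    by (intro sum.cong refl orthonormal_basis_inner[OF assms])
  also have "\<dots> = (\<Sum>v\<in>B. \<Sum>i\<in>UNIV. (M $ i \<bullet> v) * (N $ i \<bullet> v))"
    by (rule sum.swap)
  also have "\<dots> = (\<Sum>v\<in>B. (M *v v) \<bullet> (N *v v))"
    by (simp add: inner_vec_def matrix_mult_dot)
  finally show ?thesis .
qed

lemma inner_transpose_mult:
  fixes M :: "real ^ 'c ^ 'r"
  shows "(transpose M *v x) \<bullet> y = x \<bullet> (M *v y)"
  by (metis dot_lmul_matrix transpose_matrix_vector)

lemma gram_eigenbasis:
  fixes Z :: "real ^ 'c ^ 'r"
  obtains B k where "finite B" "pairwise orthogonal B" "\<And>v. v \<in> B \<Longrightarrow> norm v = 1" "span B = UNIV"
    "\<And>v. v \<in> B \<Longrightarrow> transpose Z *v (Z *v v) = k v *\<^sub>R v"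
proof -
  define f where "f v = transpose Z *v (Z *v v)" for v
  have "linear f"
    unfolding f_def
    using linear_compose[OF matrix_vector_mul_linear[of Z] matrix_vector_mul_linear[of "transpose Z"]]
    by (simp add: o_def)
  moreover have "f x \<bullet> y = x \<bullet> f y" for x y
    unfolding f_def by (metis inner_commute inner_transpose_mult)
  ultimately obtain B where B: "finite B" "pairwise orthogonal B" "\<And>v. v \<in> B \<Longrightarrow> norm v = 1" "span B = UNIV"
      "\<And>v. v \<in> B \<Longrightarrow> \<exists>k. f v = k *\<^sub>R v"
    using self_adjoint_orthonormal_eigenbasis[of f UNIV] by auto
  then obtain k where "\<And>v. v \<in> B \<Longrightarrow> f v = k v *\<^sub>R v" by metis
  with B that show thesis unfolding f_def by blast
qed

text \<open>The scalar map is odd, so its quotient by \<open>s\<close> is a polynomial in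
  \<open>k = s ^ 2\<close>. Written in \<open>k\<close> it applies directly to eigenvalues of the
  Gram matrix, without square roots, and it also makes sense at \<open>k = 0\<close>.\<close>

primrec ns_ratio ::
  "(nat \<Rightarrow> real) \<Rightarrow> (nat \<Rightarrow> real) \<Rightarrow> (nat \<Rightarrow> real) \<Rightarrow> nat \<Rightarrow> real \<Rightarrow> real" where
  "ns_ratio a b c 0 k = 1"
| "ns_ratio a b c (Suc j) k =
     (let r = ns_ratio a b c j k
      in a (Suc j) * r + b (Suc j) * (r ^ 3 * k) + c (Suc j) * (r ^ 5 * k ^ 2))"

lemma ns_scalar_eq_ratio: "ns_scalar a b c j s = ns_ratio a b c j (s ^ 2) * s"
  by (induction j) (simp_all add: Let_def algebra_simps eval_nat_numeral)

lemma ns_ratio_bounds: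
  assumes "0 < k" "k \<le> 1"
  shows "ns_lower a b c J \<le> ns_ratio a b c J k" "ns_ratio a b c J k \<le> ns_upper a b c J"
proof -
  define s where "s = sqrt k"
  have s: "s \<in> {0<..1}" "s ^ 2 = k" using assms by (auto simp: s_def)
  then have "ns_scalar a b c J s / s = ns_ratio a b c J k"
    by (simp add: ns_scalar_eq_ratio)
  then show "ns_lower a b c J \<le> ns_ratio a b c J k" "ns_ratio a b c J k \<le> ns_upper a b c J"
    using cINF_lower[OF ns_ratio_bdd(2) s(1), of a b c J]
      cSUP_upper[OF s(1) ns_ratio_bdd(1)[of a b c J]]
    by (simp_all add: ns_lower_def ns_upper_def)
qed

lemma ns_lower_le_upper: "ns_lower a b c J \<le> ns_upper a b c J"
  using ns_ratio_bounds[of 1 a b c J] by linarith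

text \<open>
  No singular value decomposition is needed: all \<open>Z\<^sub>j\<close> act on an orthonormal eigenbasis of
  \<open>Z\<^sub>0\<^sup>T Z\<^sub>0\<close> as scalar multiples of \<open>Z\<^sub>0\<close>.
\<close>

lemma ns_iter_eigenvector:
  fixes Z0 :: "real ^ 'c ^ 'r"
  assumes B: "finite B" "pairwise orthogonal B" "\<And>v. v \<in> B \<Longrightarrow> norm v = 1" "span B = UNIV"
    and k: "\<And>v. v \<in> B \<Longrightarrow> transpose Z0 *v (Z0 *v v) = k v *\<^sub>R v"
    and v: "v \<in> B"
  shows "ns_iter a b c Z0 j *v v = ns_ratio a b c j (k v) *\<^sub>R (Z0 *v v)"
  using v
proof (induction j arbitrary: v)
  case 0
  then show ?case by simp
next
  case (Suc j)
  define Z where "Z = ns_iter a b c Z0 j"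
  define r where "r w = ns_ratio a b c j (k w)" for w
  have Zw: "Z *v w = r w *\<^sub>R (Z0 *v w)" if "w \<in> B" for w
    using Suc.IH[OF that] by (simp add: Z_def r_def)
  \<comment> \<open>\<open>Z\<close> is known only through its values on \<open>B\<close>, so its
    transpose is computed by duality, pairing with each basis vector \<open>w\<close>. This produces
    the scalar \<open>r w\<close> instead of \<open>r v\<close>, which is harmless: the pairing
    vanishes unless \<open>w = v\<close>.\<close>
  have cross: "transpose Z *v (Z0 *v v) = (r v * k v) *\<^sub>R v"
  proof -
    have "(transpose Z *v (Z0 *v v)) \<bullet> w = ((r v * k v) *\<^sub>R v) \<bullet> w" if w: "w \<in> B" for w
    proof -
      have "(transpose Z *v (Z0 *v v)) \<bullet> w = r w * ((Z0 *v v) \<bullet> (Z0 *v w))"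
        by (simp add: inner_transpose_mult Zw[OF w] del: transpose_matrix_vector)
      also have "(Z0 *v v) \<bullet> (Z0 *v w) = (transpose Z0 *v (Z0 *v v)) \<bullet> w"
        by (simp add: inner_transpose_mult del: transpose_matrix_vector)
      also have "\<dots> = k v * (v \<bullet> w)" by (simp add: k[OF Suc.prems] del: transpose_matrix_vector)
      also have "r w * (k v * (v \<bullet> w)) = r v * (k v * (v \<bullet> w))"
        using B(2) w Suc.prems by (cases "v = w") (auto simp: pairwise_def orthogonal_def)
      finally show ?thesis by simp
    qed
    then have "(transpose Z *v (Z0 *v v) - (r v * k v) *\<^sub>R v) \<bullet> w = 0" if "w \<in> B" for w
      using that by (simp add: inner_diff_left)
    then have "norm (transpose Z *v (Z0 *v v) - (r v * k v) *\<^sub>R v) ^ 2 = 0"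
      unfolding power2_norm_eq_inner by (subst orthonormal_basis_inner[OF B]) auto
    then show ?thesis by simp
  qed
  have "transpose Z *v (Z *v v) = ((r v)\<^sup>2 * k v) *\<^sub>R v"
    using cross Zw[OF Suc.prems]
    by (simp add: matrix_vector_mult_scaleR power2_eq_square mult.assoc del: transpose_matrix_vector)
  then have A: "(Z ** transpose Z) *v (Z *v v) = ((r v)\<^sup>2 * k v) *\<^sub>R (Z *v v)"
    by (simp add: matrix_vector_mul_assoc[symmetric] matrix_vector_mult_scaleR
        del: transpose_matrix_vector)
  then have AA: "(Z ** transpose Z) *v ((Z ** transpose Z) *v (Z *v v)) = ((r v)\<^sup>2 * k v)\<^sup>2 *\<^sub>R (Z *v v)"
    by (simp add: matrix_vector_mult_scaleR power2_eq_square)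
  have "ns_iter a b c Z0 (Suc j) *v v =
      a (Suc j) *\<^sub>R (Z *v v) + b (Suc j) *\<^sub>R ((Z ** transpose Z) *v (Z *v v))
      + c (Suc j) *\<^sub>R ((Z ** transpose Z) *v ((Z ** transpose Z) *v (Z *v v)))"
    by (simp add: Z_def Let_def matrix_vector_mult_add_rdistrib scaleR_matrix_vector_assoc[symmetric]
        matrix_vector_mul_assoc matrix_mul_assoc)
  also have "\<dots> = a (Suc j) *\<^sub>R (Z *v v) + b (Suc j) *\<^sub>R ((r v)\<^sup>2 * k v) *\<^sub>R (Z *v v)
      + c (Suc j) *\<^sub>R ((r v)\<^sup>2 * k v)\<^sup>2 *\<^sub>R (Z *v v)"
    by (subst AA, subst A) (rule refl)
  also have "\<dots> = ns_ratio a b c (Suc j) (k v) *\<^sub>R (Z0 *v v)"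
    unfolding Zw[OF Suc.prems]
    by (simp add: r_def Let_def algebra_simps eval_nat_numeral)
  finally show ?case .
qed

text \<open>Since the normalized input has Frobenius norm one, the eigenvalues \<open>k v\<close> of
  its Gram matrix are nonnegative weights of sum one. The pairing of the normalized input with the
  output is the weighted mean of the ratios, and the squared norm of the output is the weighted mean
  of their squares. Eigenvalue zero, where the infimum and supremum say nothing, carries zero
  weight. Positivity of the lower bound lets the upper bound be squared.\<close>

lemma newton_schulz_bounds:
  fixes N :: "real ^ 'c ^ 'r"
  assumes pos: "0 < ns_lower a b c J"
  shows newton_schulz_inner: "ns_lower a b c J * norm N \<le> N \<bullet> newton_schulz a b c J N"
    and newton_schulz_norm: "norm (newton_schulz a b c J N) \<le> ns_upper a b c J"
proof -
  let ?l = "ns_lower a b c J" and ?u = "ns_upper a b c J"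
  have lu: "?l \<le> ?u" by (rule ns_lower_le_upper)
  have "?l * norm N \<le> N \<bullet> newton_schulz a b c J N \<and> norm (newton_schulz a b c J N) \<le> ?u"
  proof (cases "N = 0")
    case True
    then show ?thesis using pos lu by (simp add: newton_schulz_def)
  next
    case False
    define Z0 where "Z0 = N /\<^sub>R norm N"
    define Z where "Z = ns_iter a b c Z0 J"
    obtain B k where B: "finite B" "pairwise orthogonal B" "\<And>v. v \<in> B \<Longrightarrow> norm v = 1" "span B = UNIV"
        and k: "\<And>v. v \<in> B \<Longrightarrow> transpose Z0 *v (Z0 *v v) = k v *\<^sub>R v"
      using gram_eigenbasis[of Z0] by blast
    note frob = frobenius_inner_orthonormal_basis[OF B]
    have k_eq: "(Z0 *v v) \<bullet> (Z0 *v v) = k v" if "v \<in> B" for v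
    proof -
      have "(Z0 *v v) \<bullet> (Z0 *v v) = (transpose Z0 *v (Z0 *v v)) \<bullet> v"
        by (simp add: inner_transpose_mult del: transpose_matrix_vector)
      also have "\<dots> = k v" using B(3)[OF that] by (simp add: k[OF that] dot_square_norm del: transpose_matrix_vector)
      finally show ?thesis .
    qed
    have k_sum: "(\<Sum>v\<in>B. k v) = 1"
    proof -
      have "(\<Sum>v\<in>B. k v) = Z0 \<bullet> Z0" by (simp add: frob k_eq)
      also have "\<dots> = 1" using False by (simp add: Z0_def dot_square_norm)
      finally show ?thesis .
    qed
    have k0: "0 \<le> k v" if "v \<in> B" for v using k_eq[OF that] inner_ge_zero by metis
    have k1: "k v \<le> 1" if "v \<in> B" for v
      using member_le_sum[OF that, of k] k0 B(1) k_sum by simp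
    let ?r = "\<lambda>v. ns_ratio a b c J (k v)"
    have Zv: "Z *v v = ?r v *\<^sub>R (Z0 *v v)" if "v \<in> B" for v
      unfolding Z_def using ns_iter_eigenvector[OF B k that] .
    have "?l * (\<Sum>v\<in>B. k v) \<le> (\<Sum>v\<in>B. ?r v * k v)"
      unfolding sum_distrib_left
    proof (rule sum_mono)
      fix v assume "v \<in> B"
      then show "?l * k v \<le> ?r v * k v"
        using ns_ratio_bounds(1)[of "k v" a b c J] k0 k1
        by (cases "k v = 0") (auto intro!: mult_right_mono simp: less_le)
    qed
    also have "\<dots> = Z0 \<bullet> Z" by (simp add: frob Zv k_eq)
    finally have low: "?l \<le> Z0 \<bullet> Z" by (simp add: k_sum)
    have "N = norm N *\<^sub>R Z0" using False by (simp add: Z0_def)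
    then have "N \<bullet> Z = norm N * (Z0 \<bullet> Z)" by (metis inner_scaleR_left)
    with low have 1: "?l * norm N \<le> N \<bullet> Z"
      by (simp add: mult.commute mult_left_mono)
    have "Z \<bullet> Z = (\<Sum>v\<in>B. (?r v)\<^sup>2 * k v)"
      by (simp add: frob Zv k_eq power2_eq_square mult.assoc)
    also have "\<dots> \<le> (\<Sum>v\<in>B. ?u\<^sup>2 * k v)"
    proof (rule sum_mono)
      fix v assume "v \<in> B"
      then show "(?r v)\<^sup>2 * k v \<le> ?u\<^sup>2 * k v"
        using ns_ratio_bounds[of "k v" a b c J] k0 k1 pos
        by (cases "k v = 0") (auto intro!: mult_right_mono power_mono simp: less_le)
    qed
    also have "\<dots> = ?u\<^sup>2" by (simp add: sum_distrib_left[symmetric] k_sum)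
    finally have "(norm Z)\<^sup>2 \<le> ?u\<^sup>2" by (simp add: power2_norm_eq_inner)
    then have "norm Z \<le> ?u" by (rule power2_le_imp_le) (use pos lu in linarith)
    with 1 show ?thesis using False by (simp add: newton_schulz_def Z_def Z0_def)
  qed
  then show "?l * norm N \<le> N \<bullet> newton_schulz a b c J N" "norm (newton_schulz a b c J N) \<le> ?u"
    by auto
qed

section \<open>Zero padding, continuity and measurability of the Newton--Schulz map\<close>

definition supported_on :: "'r set \<Rightarrow> 'c set \<Rightarrow> real ^ 'c ^ 'r \<Rightarrow> bool" where
  "supported_on A B Z \<longleftrightarrow> (\<forall>i j. i \<notin> A \<or> j \<notin> B \<longrightarrow> Z $ i $ j = 0)"

lemma layer_space_iff: "X \<in> layer_space R C \<longleftrightarrow> (\<forall>l. supported_on (R l) (C l) (X $ l))"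
  by (auto simp: layer_space_def supported_on_def)

lemma supported_on_lin [simp]:
  "supported_on A B 0"
  "supported_on A B Y \<Longrightarrow> supported_on A B Z \<Longrightarrow> supported_on A B (Y + Z)"
  "supported_on A B Y \<Longrightarrow> supported_on A B Z \<Longrightarrow> supported_on A B (Y - Z)"
  "supported_on A B Z \<Longrightarrow> supported_on A B (r *\<^sub>R Z)"
  by (auto simp: supported_on_def)

lemma subspace_layer_space: "subspace (layer_space R C)"
  by (simp add: subspace_def layer_space_iff)

lemma supported_on_transpose:
  "supported_on A B Z \<Longrightarrow> supported_on B A (transpose Z)"
  by (auto simp: supported_on_def transpose_def)

lemma supported_on_mult:
  assumes "supported_on A B Y" "supported_on B D Z"
  shows "supported_on A D (Y ** Z)"
  unfolding supported_on_def
proof (intro allI impI)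
  fix i j assume "i \<notin> A \<or> j \<notin> D"
  then have "Y $ i $ k * Z $ k $ j = 0" for k using assms by (auto simp: supported_on_def)
  then show "(Y ** Z) $ i $ j = 0" by (simp only: matrix_matrix_mult_def vec_lambda_beta sum.neutral_const)
qed

text \<open>The factor \<open>Z ** transpose Z\<close> is supported on \<open>A\<close> in both
  indices, so multiplying by it from the left preserves the support of \<open>Z\<close>. This keeps
  the iterates in the parameter space, where the assumptions on derivatives hold.\<close>

lemma supported_on_newton_schulz:
  assumes "supported_on A B N"
  shows "supported_on A B (newton_schulz a b c J N)"
proof -
  have "supported_on A B (ns_iter a b c (N /\<^sub>R norm N) J)"
  proof (induction J)
    case 0
    then show ?case using assms by simp
  next
    case (Suc J)
    note Z = Suc.IH supported_on_transpose[OF Suc.IH]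
    then show ?case
      by (auto simp: Let_def intro!: supported_on_lin supported_on_mult[of A A] supported_on_mult[of A B _ A])
  qed
  then show ?thesis by (simp add: newton_schulz_def)
qed

lemma continuous_on_matrix_mult:
  fixes f :: "'a::topological_space \<Rightarrow> real ^ 'k ^ 'r" and g :: "'a \<Rightarrow> real ^ 'c ^ 'k"
  assumes "continuous_on A f" "continuous_on A g"
  shows "continuous_on A (\<lambda>x. f x ** g x)"
  unfolding matrix_matrix_mult_def
  by (intro continuous_on_vec_lambda continuous_intros assms)

lemma continuous_on_ns_iter: "continuous_on UNIV (\<lambda>Z :: real ^ 'c ^ 'r. ns_iter a b c Z j)"
proof (induction j)
  case 0
  then show ?case by simp
next
  case (Suc j)
  have "continuous_on UNIV (\<lambda>Z :: real ^ 'c ^ 'r. transpose (ns_iter a b c Z j))"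
    unfolding transpose_def by (intro continuous_on_vec_lambda continuous_intros Suc.IH)
  with Suc.IH show ?case
    by (simp add: Let_def) (intro continuous_intros continuous_on_matrix_mult)
qed

text \<open>The map may jump at \<open>0\<close>, where the normalization is singular, so continuity
  is available only for the iteration after normalization; the case distinction is on a Borel
  set.\<close>

lemma borel_measurable_newton_schulz:
  "(newton_schulz a b c J :: real ^ 'c ^ 'r \<Rightarrow> _) \<in> borel_measurable borel"
proof -
  have [measurable]: "(\<lambda>Z :: real ^ 'c ^ 'r. ns_iter a b c Z J) \<in> borel_measurable borel"
    by (rule borel_measurable_continuous_onI[OF continuous_on_ns_iter])
  show ?thesis unfolding newton_schulz_def by measurable
qed

subsection \<open>Gradients on a subspace\<close>

text \<open>A sequence of difference quotients is used, rather than a limit over a real parameter,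
  because it serves twice: it shows that the gradient is unique, and it exhibits coordinates of the
  gradient as pointwise limits of measurable functions.\<close>

lemma derivative_on_subspace_limit:
  fixes g :: "'a::euclidean_space \<Rightarrow> real"
  assumes S: "subspace S" and X: "X \<in> S" and H: "H \<in> S"
    and d: "(g has_derivative (\<lambda>H. G \<bullet> H)) (at X within S)"
  shows "(\<lambda>n. real (Suc n) * (g (X + (1 / real (Suc n)) *\<^sub>R H) - g X)) \<longlonglongrightarrow> G \<bullet> H"
proof -
  define \<phi> where "\<phi> s = X + s *\<^sub>R H" for s
  have \<phi>S: "\<phi> ` UNIV \<subseteq> S" using S X H by (auto simp: \<phi>_def subspace_add subspace_scale)
  have "(\<phi> has_derivative (\<lambda>s. s *\<^sub>R H)) (at 0)"
    unfolding \<phi>_def by (auto intro!: derivative_eq_intros)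
  moreover have "(g has_derivative (\<lambda>H. G \<bullet> H)) (at (\<phi> 0) within \<phi> ` UNIV)"
    using has_derivative_subset[OF d \<phi>S] by (simp add: \<phi>_def)
  ultimately have "((\<lambda>s. g (\<phi> s)) has_derivative (\<lambda>s. G \<bullet> (s *\<^sub>R H))) (at 0)"
    by (rule has_derivative_in_compose)
  then have "((\<lambda>s. g (\<phi> s)) has_field_derivative G \<bullet> H) (at 0)"
    by (simp add: has_field_derivative_def mult.commute[of _ "G \<bullet> H"] mult_commute_abs)
  then have "((\<lambda>h. (g (\<phi> h) - g (\<phi> 0)) / h) \<longlongrightarrow> G \<bullet> H) (at 0)"
    by (simp add: DERIV_def)
  moreover have "filterlim (\<lambda>n. 1 / real (Suc n)) (at 0) sequentially"
    by (intro filterlim_atI LIMSEQ_Suc[OF lim_1_over_n]) auto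
  ultimately have "(\<lambda>n. (g (\<phi> (1 / real (Suc n))) - g (\<phi> 0)) / (1 / real (Suc n))) \<longlonglongrightarrow> G \<bullet> H"
    by (rule filterlim_compose)
  then show ?thesis by (simp add: \<phi>_def mult.commute)
qed

text \<open>A derivative within \<open>S\<close> matters only on differences of points of
  \<open>S\<close>, so the representing vector may be projected orthogonally onto \<open>S\<close>
  without changing it there. Two candidates in \<open>S\<close> differ by a vector of
  \<open>S\<close>, along which both give the same directional derivative.\<close>

lemma grad_on_exists1:
  fixes g :: "'a::euclidean_space \<Rightarrow> real"
  assumes S: "subspace S" and X: "X \<in> S" and diff: "g differentiable_on S"
  shows "\<exists>!G. G \<in> S \<and> (g has_derivative (\<lambda>H. G \<bullet> H)) (at X within S)"
proof (rule ex_ex1I)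
  obtain D where D: "(g has_derivative D) (at X within S)"
    using diff X by (auto simp: differentiable_on_def differentiable_def)
  then have lin: "linear D" using has_derivative_linear by blast
  define G0 where "G0 = adjoint D 1"
  have G0: "D H = G0 \<bullet> H" for H
    using adjoint_works[OF lin, of H 1] by (simp add: G0_def inner_commute)
  obtain G e where G: "G \<in> S" "G0 = G + e" and e: "\<And>w. w \<in> S \<Longrightarrow> orthogonal e w"
    using orthogonal_subspace_decomp_exists[of S G0] S by (metis span_eq_iff)
  have DG: "D H = G \<bullet> H" if "H \<in> S" for H
    using e[OF that] by (simp add: G0 G(2) inner_add_left orthogonal_def)
  have "(g has_derivative (\<lambda>H. G \<bullet> H)) (at X within S)"
    using D unfolding has_derivative_within'
    by (auto simp: bounded_linear_inner_right DG[symmetric] subspace_diff[OF S _ X])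
  with G(1) show "\<exists>G. G \<in> S \<and> (g has_derivative (\<lambda>H. G \<bullet> H)) (at X within S)" by blast
next
  fix G G'
  assume G: "G \<in> S \<and> (g has_derivative (\<lambda>H. G \<bullet> H)) (at X within S)"
    and G': "G' \<in> S \<and> (g has_derivative (\<lambda>H. G' \<bullet> H)) (at X within S)"
  have H: "G - G' \<in> S" using G G' S subspace_diff by blast
  have "G \<bullet> (G - G') = G' \<bullet> (G - G')"
    using derivative_on_subspace_limit[OF S X H] G G' LIMSEQ_unique by blast
  then have "(G - G') \<bullet> (G - G') = 0" by (simp add: inner_diff_left)
  then show "G = G'" by simp
qed

lemma
  fixes g :: "'a::euclidean_space \<Rightarrow> real"
  assumes S: "subspace S" and X: "X \<in> S" and diff: "g differentiable_on S"
  shows grad_on_mem: "grad_on S g X \<in> S"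
    and has_derivative_grad_on: "(g has_derivative (\<lambda>H. grad_on S g X \<bullet> H)) (at X within S)"
  using theI'[OF grad_on_exists1[OF assms]] by (auto simp: grad_on_def)

text \<open>Weighted arithmetic-geometric mean of \<open>x\<close> and \<open>1\<close>. This is the
  origin of the constant \<open>L0 + (1 - q) * L1\<close> and of the coefficient
  \<open>q * L1\<close> of the gradient norm. The conditional takes the value that makes the case
  \<open>q = 0\<close> an equality, also at \<open>x = 0\<close>.\<close>

lemma powr_le_affine:
  fixes x q :: real
  assumes "0 \<le> x" "0 \<le> q" "q \<le> 1"
  shows "(if q = 0 then 1 else x powr q) \<le> q * x + (1 - q)"
proof (cases "q = 0 \<or> x = 0")
  case True
  then show ?thesis using assms by auto
next
  case False
  then have "x powr q * 1 powr (1 - q) \<le> q * x + (1 - q) * 1"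
    using Youngs_inequality_0[of q "1 - q" x 1] assms by simp
  then show ?thesis using False by simp
qed

lemma joint_smooth_on_affine:
  fixes F :: "'a::euclidean_space \<Rightarrow> real"
  assumes smooth: "joint_smooth_on S F L0 L1 q" and "L1 \<ge> 0" "0 \<le> q" "q \<le> 1"
    and X: "X \<in> S" and Y: "Y \<in> S"
  shows "norm (grad_on S F X - grad_on S F Y)
      \<le> (L0 + (1 - q) * L1 + q * L1 * norm (grad_on S F X)) * norm (X - Y)"
proof -
  have "norm (grad_on S F X - grad_on S F Y)
      \<le> (L0 + L1 * (if q = 0 then 1 else norm (grad_on S F X) powr q)) * norm (X - Y)"
    using smooth X Y by (auto simp: joint_smooth_on_def)
  also have "\<dots> \<le> (L0 + L1 * (q * norm (grad_on S F X) + (1 - q))) * norm (X - Y)"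
    using assms(2-4)
    by (intro mult_right_mono add_left_mono mult_left_mono powr_le_affine) auto
  finally show ?thesis by (simp add: algebra_simps)
qed

text \<open>The Lipschitz bound is required only between \<open>X\<close> and other points, since a
  local constant is attached to one endpoint. The quadratic upper model minus \<open>F\<close> is
  monotone along the segment, which avoids integrating the gradient.\<close>

lemma descent_on_subspace:
  fixes F :: "'a::euclidean_space \<Rightarrow> real"
  assumes S: "subspace S" and X: "X \<in> S" and Y: "Y \<in> S" and diff: "F differentiable_on S"
    and lip: "\<And>Z. Z \<in> S \<Longrightarrow> norm (grad_on S F X - grad_on S F Z) \<le> K * norm (X - Z)"
  shows "F Y \<le> F X + grad_on S F X \<bullet> (Y - X) + K / 2 * (norm (Y - X))\<^sup>2"
proof -
  define H where "H = Y - X"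
  define \<phi> where "\<phi> s = X + s *\<^sub>R H" for s
  have H: "H \<in> S" using S X Y by (simp add: H_def subspace_diff)
  have \<phi>S: "\<phi> s \<in> S" for s using S X H by (auto simp: \<phi>_def subspace_add subspace_scale)
  define h where "h s = F (\<phi> s) - s * (grad_on S F X \<bullet> H) - K / 2 * (norm H)\<^sup>2 * s\<^sup>2" for s
  have deriv: "((\<lambda>s. F (\<phi> s)) has_field_derivative grad_on S F (\<phi> s) \<bullet> H) (at s)" for s
  proof -
    have "(\<phi> has_derivative (\<lambda>s. s *\<^sub>R H)) (at s)"
      unfolding \<phi>_def by (auto intro!: derivative_eq_intros)
    moreover have "(F has_derivative (\<lambda>H. grad_on S F (\<phi> s) \<bullet> H)) (at (\<phi> s) within \<phi> ` UNIV)"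
      using has_derivative_subset[OF has_derivative_grad_on[OF S \<phi>S diff]] \<phi>S by blast
    ultimately have "((\<lambda>s. F (\<phi> s)) has_derivative (\<lambda>r. grad_on S F (\<phi> s) \<bullet> (r *\<^sub>R H))) (at s)"
      by (rule has_derivative_in_compose)
    then show ?thesis
      by (simp add: has_field_derivative_def mult_commute_abs)
  qed
  have "h 1 \<le> h 0"
  proof (rule DERIV_nonpos_imp_nonincreasing[of 0 1 h])
    fix s :: real assume s: "0 \<le> s" "s \<le> 1"
    have "(grad_on S F (\<phi> s) - grad_on S F X) \<bullet> H \<le> norm (grad_on S F X - grad_on S F (\<phi> s)) * norm H"
      by (metis norm_cauchy_schwarz norm_minus_commute)
    also have "\<dots> \<le> (K * norm (X - \<phi> s)) * norm H"
      by (intro mult_right_mono lip \<phi>S) auto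
    also have "norm (X - \<phi> s) = s * norm H" using s by (simp add: \<phi>_def)
    finally have "grad_on S F (\<phi> s) \<bullet> H - grad_on S F X \<bullet> H - K * (norm H)\<^sup>2 * s \<le> 0"
      by (simp add: inner_diff_left power2_eq_square algebra_simps)
    moreover have "(h has_real_derivative
        grad_on S F (\<phi> s) \<bullet> H - grad_on S F X \<bullet> H - K * (norm H)\<^sup>2 * s) (at s)"
      unfolding h_def by (auto intro!: derivative_eq_intros deriv)
    ultimately show "\<exists>y. (h has_real_derivative y) (at s) \<and> y \<le> 0" by blast
  qed simp
  then show ?thesis by (simp add: h_def \<phi>_def H_def)
qed

lemma continuous_on_grad_on:
  fixes F :: "'a::euclidean_space \<Rightarrow> real"
  assumes smooth: "joint_smooth_on S F L0 L1 q" and "L1 \<ge> 0" "0 \<le> q" "q \<le> 1"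
  shows "continuous_on S (grad_on S F)"
  unfolding continuous_on_def
proof
  fix X assume X: "X \<in> S"
  define K where "K = L0 + (1 - q) * L1 + q * L1 * norm (grad_on S F X)"
  have "((\<lambda>Y. K * norm (X - Y)) \<longlongrightarrow> K * norm (X - X)) (at X within S)"
    by (intro tendsto_intros)
  then have lim: "((\<lambda>Y. K * norm (X - Y)) \<longlongrightarrow> 0) (at X within S)"
    by simp
  have "((\<lambda>Y. grad_on S F Y - grad_on S F X) \<longlongrightarrow> 0) (at X within S)"
  proof (rule Lim_null_comparison[OF _ lim])
    have "norm (grad_on S F Y - grad_on S F X) \<le> K * norm (X - Y)" if "Y \<in> S" for Y
      using joint_smooth_on_affine[OF assms X that] norm_minus_commute
      unfolding K_def by metis
    then show "\<forall>\<^sub>F Y in at X within S. norm (grad_on S F Y - grad_on S F X) \<le> K * norm (X - Y)"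
      by (simp add: eventually_at_filter)
  qed
  then show "(grad_on S F \<longlongrightarrow> grad_on S F X) (at X within S)"
    by (simp add: LIM_zero_iff)
qed

subsection \<open>Joint measurability of the stochastic gradient\<close>

text \<open>The point \<open>x\<close> is replaced by the first member of a countable dense sequence
  within distance \<open>1 / (n + 1)\<close>. The index of that member is a measurable function with
  countably many values, so each approximation is jointly measurable, and continuity in
  \<open>x\<close> gives the pointwise limit.\<close>

lemma caratheodory_measurable:
  fixes f :: "'a::{metric_space, second_countable_topology} \<Rightarrow> 'z \<Rightarrow> 'b::{second_countable_topology, metric_space}"
  assumes meas: "\<And>x. x \<in> S \<Longrightarrow> f x \<in> borel_measurable M"
    and cont: "\<And>z. z \<in> space M \<Longrightarrow> continuous_on S (\<lambda>x. f x z)"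
  shows "(\<lambda>(x, z). f x z) \<in> borel_measurable (restrict_space borel S \<Otimes>\<^sub>M M)"
proof (cases "S = {}")
  case True
  then have "space (restrict_space borel S \<Otimes>\<^sub>M M) = {}"
    by (simp add: space_pair_measure space_restrict_space)
  then show ?thesis by (simp add: measurable_def)
next
  case False
  obtain D where D: "countable D" "D \<subseteq> S" "S \<subseteq> closure D"
    using separable[of S] by metis
  have "D \<noteq> {}" using D(3) False by auto
  define d where "d = from_nat_into D"
  have dS: "d k \<in> S" for k using from_nat_into[OF \<open>D \<noteq> {}\<close>] D(2) by (auto simp: d_def)
  define g where "g n x = (LEAST k. dist x (d k) < 1 / real (Suc n))" for n x
  have close: "dist x (d (g n x)) < 1 / real (Suc n)" if "x \<in> S" for x n
  proof -
    have "x \<in> closure D" using D(3) that by blast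
    then obtain y where "y \<in> D" "dist y x < 1 / real (Suc n)"
      unfolding closure_approachable by (metis divide_pos_pos of_nat_0_less_iff zero_less_Suc zero_less_one)
    then have "dist x (d (to_nat_on D y)) < 1 / real (Suc n)"
      using D(1) by (simp add: d_def dist_commute)
    then show ?thesis unfolding g_def by (rule LeastI)
  qed
  show ?thesis
  proof (rule borel_measurable_LIMSEQ_metric)
    fix n
    have [measurable]: "fst \<in> borel_measurable (restrict_space borel S \<Otimes>\<^sub>M M)"
      using measurable_compose[OF measurable_fst measurable_restrict_space1[OF measurable_ident]]
      by (simp add: id_def)
    have [measurable]: "f (d k) \<in> borel_measurable M" for k by (rule meas[OF dS])
    have g: "(\<lambda>p. g n (fst p)) \<in> measurable (restrict_space borel S \<Otimes>\<^sub>M M) (count_space UNIV)"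
      unfolding g_def by measurable
    show "(\<lambda>p. f (d (g n (fst p))) (snd p)) \<in> borel_measurable (restrict_space borel S \<Otimes>\<^sub>M M)"
      by (rule measurable_compose_countable[OF _ g]) measurable
  next
    fix p assume "p \<in> space (restrict_space borel S \<Otimes>\<^sub>M M)"
    then have x: "fst p \<in> S" and z: "snd p \<in> space M"
      by (auto simp: space_pair_measure space_restrict_space)
    have "(\<lambda>n. d (g n (fst p))) \<longlonglongrightarrow> fst p"
    proof (rule metric_tendsto_imp_tendsto[OF LIMSEQ_Suc[OF lim_1_over_n]])
      show "\<forall>\<^sub>F n in sequentially. dist (d (g n (fst p))) (fst p) \<le> dist (1 / real (Suc n)) 0"
        using close[OF x] by (intro always_eventually) (simp add: dist_commute less_imp_le)
    qed
    then have "(\<lambda>n. f (d (g n (fst p))) (snd p)) \<longlonglongrightarrow> f (fst p) (snd p)"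
      by (intro continuous_on_tendsto_compose[OF cont[OF z] _ x]) (auto simp: dS)
    then show "(\<lambda>n. f (d (g n (fst p))) (snd p)) \<longlonglongrightarrow> (case p of (x, z) \<Rightarrow> f x z)"
      by (simp add: case_prod_beta)
  qed
qed

text \<open>Coordinates of the gradient are limits of difference quotients of the jointly measurable
  \<open>f\<close>. They are taken along an orthonormal basis of \<open>S\<close>, not of the whole
  space, so that the shifted points stay in \<open>S\<close>; the basis recovers the gradient
  because it lies in \<open>S\<close>.\<close>

lemma measurable_grad_on:
  fixes f :: "'a::euclidean_space \<Rightarrow> 'z \<Rightarrow> real"
  assumes S: "subspace S"
    and meas: "\<And>x. x \<in> S \<Longrightarrow> f x \<in> borel_measurable M"
    and diff: "\<And>z. z \<in> space M \<Longrightarrow> (\<lambda>x. f x z) differentiable_on S"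
  shows "(\<lambda>(x, z). grad_on S (\<lambda>y. f y z) x) \<in> borel_measurable (restrict_space borel S \<Otimes>\<^sub>M M)"
    (is "?g \<in> borel_measurable ?N")
proof -
  obtain B where B: "B \<subseteq> S" "pairwise orthogonal B" "\<And>x. x \<in> B \<Longrightarrow> norm x = 1"
      "independent B" "card B = dim S" "span B = S"
    using orthonormal_basis_subspace[OF S] by blast
  have fin: "finite B" using B(4) by (rule independent_imp_finite)
  have f[measurable]: "(\<lambda>(x, z). f x z) \<in> borel_measurable ?N"
    using diff by (intro caratheodory_measurable meas differentiable_imp_continuous_on) auto
  have coord: "(\<lambda>p. ?g p \<bullet> b) \<in> borel_measurable ?N" if b: "b \<in> B" for b
  proof (rule borel_measurable_LIMSEQ_metric)
    fix n
    have "(\<lambda>x. x + (1 / real (Suc n)) *\<^sub>R b) \<in> measurable (restrict_space borel S) (restrict_space borel S)"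
      using S B(1) b
      by (intro measurable_restrict_space3) (auto simp: subspace_add subspace_scale)
    then have [measurable]: "(\<lambda>p. (fst p + (1 / real (Suc n)) *\<^sub>R b, snd p)) \<in> measurable ?N ?N"
      by measurable
    have "(\<lambda>p. (\<lambda>(x, z). f x z) (fst p + (1 / real (Suc n)) *\<^sub>R b, snd p)) \<in> borel_measurable ?N"
      by measurable
    with f show "(\<lambda>p. real (Suc n) * (f (fst p + (1 / real (Suc n)) *\<^sub>R b) (snd p) - f (fst p) (snd p)))
        \<in> borel_measurable ?N"
      by (intro borel_measurable_times borel_measurable_diff borel_measurable_const)
        (simp_all add: case_prod_beta)
  next
    fix p assume "p \<in> space ?N"
    then have x: "fst p \<in> S" and z: "snd p \<in> space M"
      by (auto simp: space_pair_measure space_restrict_space)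
    show "(\<lambda>n. real (Suc n) * (f (fst p + (1 / real (Suc n)) *\<^sub>R b) (snd p) - f (fst p) (snd p)))
        \<longlonglongrightarrow> ?g p \<bullet> b"
      using derivative_on_subspace_limit[OF S x _ has_derivative_grad_on[OF S x diff[OF z]], of b] B(1) b
      by (auto simp: case_prod_beta)
  qed
  have "(\<lambda>p. \<Sum>b\<in>B. (?g p \<bullet> b) *\<^sub>R b) \<in> borel_measurable ?N"
    using coord by (intro borel_measurable_sum borel_measurable_scaleR) auto
  moreover have "(\<Sum>b\<in>B. (?g p \<bullet> b) *\<^sub>R b) = ?g p" if "p \<in> space ?N" for p
  proof -
    have "?g p \<in> S"
      using that grad_on_mem[OF S _ diff] by (auto simp: space_pair_measure space_restrict_space)
    then show ?thesis
      using orthonormal_basis_expand[OF B(2,3) _ fin] B(6) by blast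
  qed
  ultimately show ?thesis
    using measurable_cong[of ?N] by (metis (no_types, lifting))
qed

subsection \<open>The pathwise descent estimate\<close>

lemma norm_le_sum_norm_nth: "norm (v :: 'a::real_normed_vector ^ 'l) \<le> (\<Sum>l\<in>UNIV. norm (v $ l))"
  unfolding norm_vec_def by (rule L2_set_le_sum) simp

lemma sum_norm_nth_le:
  "(\<Sum>l\<in>UNIV. norm ((v :: 'a::real_normed_vector ^ 'l) $ l)) \<le> sqrt (real CARD('l)) * norm v"
  using L2_set_mult_ineq[of "\<lambda>_. 1" "\<lambda>l. norm (v $ l)" "UNIV :: 'l set"]
  by (simp add: norm_vec_def L2_set_def)

lemma norm_le_of_nth_le:
  fixes v :: "'a::real_normed_vector ^ 'l"
  assumes "\<And>l. norm (v $ l) \<le> u"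
  shows "norm v \<le> sqrt (real CARD('l)) * u"
proof -
  have u: "0 \<le> u" using assms norm_ge_zero order_trans by blast
  have "norm v \<le> sqrt (\<Sum>l\<in>(UNIV :: 'l set). u\<^sup>2)"
    unfolding norm_vec_def L2_set_def
    by (intro real_sqrt_le_mono sum_mono power_mono assms) simp
  also have "\<dots> = sqrt (real CARD('l)) * u" using u by (simp add: real_sqrt_mult)
  finally show ?thesis .
qed

lemma damped_recursion_sum:
  fixes B y :: "nat \<Rightarrow> real"
  assumes \<beta>: "0 \<le> \<beta>" "\<beta> \<le> 1" and nonneg: "\<And>t. 0 \<le> B t" "\<And>t. 0 \<le> y t"
    and rec: "\<And>t. B (Suc t) \<le> \<beta> * (B t + y t)"
  shows "(1 - \<beta>) * (\<Sum>t=1..T. B t) \<le> B 0 + (\<Sum>t<T. y t)"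
proof -
  \<comment> \<open>The additional term \<open>\<beta> * B T\<close> is what the next step of the
    recursion consumes, so the induction needs it on the left.\<close>
  have "(1 - \<beta>) * (\<Sum>t=1..T. B t) + \<beta> * B T \<le> B 0 + (\<Sum>t<T. y t)"
  proof (induction T)
    case 0
    then show ?case using \<beta> nonneg(1)[of 0] by (simp add: mult_left_le_one_le)
  next
    case (Suc T)
    have "\<beta> * y T \<le> y T" using \<beta> nonneg(2)[of T] by (simp add: mult_left_le_one_le)
    then show ?case using Suc.IH rec[of T] by (simp add: algebra_simps)
  qed
  moreover have "0 \<le> \<beta> * B T" using \<beta> nonneg by simp
  ultimately show ?thesis by linarith
qed

text \<open>
  The momentum error \<open>M\<^sub>t - \<nabla>F(X\<^sub>t)\<close> splits into a bias driven by the drift of the gradients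
  and an average of the noise. With the convention \<open>\<nabla>F(X\<^sub>0) = \<nabla>F(X\<^sub>1)\<close> the recursion also
  covers the first step, where \<open>M\<^sub>0 = 0\<close> makes the bias \<open>-\<nabla>F(X\<^sub>1)\<close>.
\<close>

primrec momentum_bias :: "real \<Rightarrow> (nat \<Rightarrow> 'a::real_vector) \<Rightarrow> nat \<Rightarrow> 'a" where
  "momentum_bias \<beta> g 0 = - g 1"
| "momentum_bias \<beta> g (Suc t) = \<beta> *\<^sub>R (momentum_bias \<beta> g t + (g (max 1 t) - g (Suc t)))"

primrec momentum_noise :: "real \<Rightarrow> (nat \<Rightarrow> 'a::real_vector) \<Rightarrow> nat \<Rightarrow> 'a" where
  "momentum_noise \<beta> n 0 = 0"
| "momentum_noise \<beta> n (Suc t) = \<beta> *\<^sub>R momentum_noise \<beta> n t + (1 - \<beta>) *\<^sub>R n (Suc t)"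

text \<open>The average over the past and the fresh noise are kept apart because they are orthogonal
  in mean square. The fresh noise enters once through the momentum and once directly, and
  \<open>\<beta>2 * (1 - \<beta>1) + (1 - \<beta>2) = 1 - \<beta>1 * \<beta>2\<close>.\<close>

definition nesterov_noise :: "real \<Rightarrow> real \<Rightarrow> (nat \<Rightarrow> 'a::real_vector) \<Rightarrow> nat \<Rightarrow> 'a" where
  "nesterov_noise \<beta>1 \<beta>2 n t =
     (\<beta>2 * \<beta>1) *\<^sub>R momentum_noise \<beta>1 n (t - 1) + (1 - \<beta>1 * \<beta>2) *\<^sub>R n t"

lemma momentum_error_decomposition:
  fixes M G g :: "nat \<Rightarrow> 'a::real_vector"
  assumes M0: "M 0 = 0"
    and M: "\<And>t. t \<in> {1..T} \<Longrightarrow> M t = \<beta>1 *\<^sub>R M (t - 1) + (1 - \<beta>1) *\<^sub>R G t"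
  shows "t \<le> T \<Longrightarrow> M t - g (max 1 t)
      = momentum_bias \<beta>1 g t + momentum_noise \<beta>1 (\<lambda>s. G s - g s) t"
proof (induction t)
  case 0
  then show ?case by (simp add: M0)
next
  case (Suc t)
  have "M (Suc t) - g (Suc t) = \<beta>1 *\<^sub>R (M t - g (max 1 t)) + \<beta>1 *\<^sub>R (g (max 1 t) - g (Suc t))
      + (1 - \<beta>1) *\<^sub>R (G (Suc t) - g (Suc t))"
    using M[of "Suc t"] Suc.prems by (simp add: algebra_simps)
  then show ?case using Suc by (simp add: algebra_simps)
qed

lemma nesterov_error_decomposition:
  fixes M G g :: "nat \<Rightarrow> 'a::real_vector"
  assumes M0: "M 0 = 0"
    and M: "\<And>t. t \<in> {1..T} \<Longrightarrow> M t = \<beta>1 *\<^sub>R M (t - 1) + (1 - \<beta>1) *\<^sub>R G t"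
    and t: "t \<in> {1..T}"
  shows "\<beta>2 *\<^sub>R M t + (1 - \<beta>2) *\<^sub>R G t - g t
      = \<beta>2 *\<^sub>R momentum_bias \<beta>1 g t + nesterov_noise \<beta>1 \<beta>2 (\<lambda>s. G s - g s) t"
proof -
  obtain s where s: "t = Suc s" using t by (cases t) auto
  have "\<beta>2 *\<^sub>R M t + (1 - \<beta>2) *\<^sub>R G t - g t = \<beta>2 *\<^sub>R (M t - g t) + (1 - \<beta>2) *\<^sub>R (G t - g t)"
    by (simp add: algebra_simps)
  also have "M t - g t = momentum_bias \<beta>1 g t + momentum_noise \<beta>1 (\<lambda>s. G s - g s) t"
    using momentum_error_decomposition[OF M0 M, of T t g] t by (simp add: max_absorb2)
  finally show ?thesis
    by (simp add: s nesterov_noise_def algebra_simps)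
qed

text \<open>Entirely deterministic: \<open>G\<close> is any sequence, and \<open>orth\<close> is
  known only by its pairing and norm bounds. In the bias, one factor \<open>sqrt L\<close> comes
  from the joint length of a step made of \<open>L\<close> layer steps, the other from passing from
  the joint norm of a gradient difference to the sum of its layer norms. In the descent step the
  squared length alone gives \<open>L\<close>.\<close>

lemma muon_pathwise_bound:
  fixes S :: "(real ^ 'c ^ 'r ^ 'l) set" and F :: "real ^ 'c ^ 'r ^ 'l \<Rightarrow> real"
    and X Mom G :: "nat \<Rightarrow> real ^ 'c ^ 'r ^ 'l" and Fstar L0 L1 q \<beta>1 \<beta>2 \<gamma> lo u :: real
  defines "g \<equiv> \<lambda>t. grad_on S F (X t)"
    and "L \<equiv> real CARD('l)"
    and "\<kappa> \<equiv> L0 + (1 - q) * L1"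
  assumes S: "subspace S" and lower: "\<forall>Y\<in>S. Fstar \<le> F Y"
    and const: "L0 > 0" "L1 \<ge> 0" "0 \<le> q" "q \<le> 1" and smooth: "joint_smooth_on S F L0 L1 q"
    and XS: "\<And>t. t \<in> {1..T + 1} \<Longrightarrow> X t \<in> S"
    and Mom0: "Mom 0 = 0"
    and Mom: "\<And>t. t \<in> {1..T} \<Longrightarrow> Mom t = \<beta>1 *\<^sub>R Mom (t - 1) + (1 - \<beta>1) *\<^sub>R G t"
    and step: "\<And>t l. t \<in> {1..T} \<Longrightarrow>
      X (t + 1) $ l = X t $ l - \<gamma> *\<^sub>R orth ((\<beta>2 *\<^sub>R Mom t + (1 - \<beta>2) *\<^sub>R G t) $ l)"
    and params: "0 \<le> \<beta>1" "\<beta>1 < 1" "0 \<le> \<beta>2" "\<beta>2 \<le> 1" "\<gamma> > 0"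
    and orth_inner: "\<And>N. lo * norm N \<le> N \<bullet> orth N"
    and orth_norm: "\<And>N. norm (orth N) \<le> u" and lo: "0 \<le> lo"
  shows "(lo - \<gamma> * L * u\<^sup>2 * q * L1 / 2 - \<gamma> * L * u * (lo + u) * q * L1 / (1 - \<beta>1))
           * (\<Sum>t=1..T. \<Sum>l\<in>UNIV. norm (g t $ l))
         \<le> (F (X 1) - Fstar) / \<gamma> + \<beta>2 * (lo + u) * (\<Sum>l\<in>UNIV. norm (g 1 $ l)) / (1 - \<beta>1)
           + (lo + u) * (\<Sum>t=1..T. \<Sum>l\<in>UNIV. norm (nesterov_noise \<beta>1 \<beta>2 (\<lambda>s. G s - g s) t $ l))
           + real T * (\<gamma> * \<beta>2 * L * u * (lo + u) * \<kappa> / (1 - \<beta>1) + \<gamma> * L * u\<^sup>2 * \<kappa> / 2)"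
proof -
  have diff: "F differentiable_on S" using smooth by (simp add: joint_smooth_on_def)
  define N where "N t = \<beta>2 *\<^sub>R Mom t + (1 - \<beta>2) *\<^sub>R G t" for t
  define W where "W = nesterov_noise \<beta>1 \<beta>2 (\<lambda>s. G s - g s)"
  define b where "b = momentum_bias \<beta>1 g"
  define gs where "gs t = (\<Sum>l\<in>UNIV. norm (g t $ l))" for t
  define Ws where "Ws t = (\<Sum>l\<in>UNIV. norm (W t $ l))" for t
  define bs where "bs t = (\<Sum>l\<in>UNIV. norm (b t $ l))" for t
  define \<delta> where "\<delta> = 1 - \<beta>1"
  have \<delta>: "\<delta> > 0" using params by (simp add: \<delta>_def)
  have u: "0 \<le> u" using orth_norm norm_ge_zero order_trans by blast
  have L: "0 \<le> L" by (simp add: L_def)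
  have \<kappa>: "0 \<le> \<kappa>" using const by (simp add: \<kappa>_def)
  have gs0: "0 \<le> gs t" and bs0: "0 \<le> bs t" for t by (simp_all add: gs_def bs_def sum_nonneg)
  have qL1: "0 \<le> q * L1" using const by simp
  \<comment> \<open>The joint gradient norm in the local Lipschitz constant is traded for the sum of
    layer norms, which is the quantity on the left of the claim and can be absorbed there.\<close>
  have K: "\<kappa> + q * L1 * norm (g t) \<le> \<kappa> + q * L1 * gs t" for t
    unfolding gs_def by (intro add_left_mono mult_left_mono norm_le_sum_norm_nth qL1)
  have dX: "norm (X (t + 1) - X t) \<le> \<gamma> * u * sqrt L" if t: "t \<in> {1..T}" for t
  proof -
    have "norm ((X (t + 1) - X t) $ l) \<le> \<gamma> * u" for l
      using step[OF t] orth_norm params by (simp add: mult_left_mono)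
    then show ?thesis using norm_le_of_nth_le[of "X (t + 1) - X t" "\<gamma> * u"]
      by (simp add: L_def mult.commute)
  qed
  have descent: "lo * gs t \<le> (F (X t) - F (X (t + 1))) / \<gamma> + (lo + u) * (\<beta>2 * bs t + Ws t)
      + \<gamma> * L * u\<^sup>2 / 2 * (\<kappa> + q * L1 * gs t)" if t: "t \<in> {1..T}" for t
  proof -
    have xt: "X t \<in> S" "X (t + 1) \<in> S" using XS t by auto
    have "F (X (t + 1)) \<le> F (X t) + g t \<bullet> (X (t + 1) - X t)
        + (\<kappa> + q * L1 * norm (g t)) / 2 * (norm (X (t + 1) - X t))\<^sup>2"
      unfolding g_def \<kappa>_def
      using joint_smooth_on_affine[OF smooth const(2-4) xt(1)]
      by (intro descent_on_subspace[OF S xt diff]) auto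
    also have "(\<kappa> + q * L1 * norm (g t)) / 2 * (norm (X (t + 1) - X t))\<^sup>2
        \<le> (\<kappa> + q * L1 * gs t) / 2 * (\<gamma> * u * sqrt L)\<^sup>2"
      using K[of t] dX[OF t] \<kappa> qL1 gs0[of t] by (intro mult_mono power_mono) auto
    also have "(\<gamma> * u * sqrt L)\<^sup>2 = \<gamma>\<^sup>2 * u\<^sup>2 * L" using L by (simp add: power_mult_distrib)
    also have "g t \<bullet> (X (t + 1) - X t) = - \<gamma> * (\<Sum>l\<in>UNIV. g t $ l \<bullet> orth (N t $ l))"
    proof -
      have "(X (t + 1) - X t) $ l = - (\<gamma> *\<^sub>R orth (N t $ l))" for l
        using step[OF t] by (simp add: N_def)
      moreover have "g t \<bullet> (X (t + 1) - X t) = (\<Sum>l\<in>UNIV. g t $ l \<bullet> (X (t + 1) - X t) $ l)"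
        by (rule inner_vec_def)
      ultimately show ?thesis by (simp only: inner_minus_right inner_scaleR_right)
        (simp add: sum_distrib_left sum_negf)
    qed
    finally have 1: "\<gamma> * (\<Sum>l\<in>UNIV. g t $ l \<bullet> orth (N t $ l))
        \<le> F (X t) - F (X (t + 1)) + (\<kappa> + q * L1 * gs t) / 2 * (\<gamma>\<^sup>2 * u\<^sup>2 * L)" by simp
    have err: "N t - g t = \<beta>2 *\<^sub>R b t + W t"
      unfolding N_def b_def W_def by (rule nesterov_error_decomposition[OF Mom0 Mom t])
    have "lo * norm (g t $ l) - (lo + u) * (\<beta>2 * norm (b t $ l) + norm (W t $ l))
        \<le> g t $ l \<bullet> orth (N t $ l)" for l
    proof -
      \<comment> \<open>The error is paid twice: a factor \<open>u\<close> for pairing it with the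
        output, and a factor \<open>lo\<close> for replacing the norm of \<open>N\<close> by that of
        the gradient.\<close>
      define e where "e = N t $ l - g t $ l"
      have "e = \<beta>2 *\<^sub>R b t $ l + W t $ l"
        using arg_cong[OF err, of "\<lambda>v. v $ l"] by (simp add: e_def)
      then have e: "norm e \<le> \<beta>2 * norm (b t $ l) + norm (W t $ l)"
        using norm_triangle_ineq[of "\<beta>2 *\<^sub>R b t $ l" "W t $ l"] params by simp
      have "e \<bullet> orth (N t $ l) \<le> norm e * u"
        using norm_cauchy_schwarz[of e "orth (N t $ l)"] mult_left_mono[OF orth_norm[of "N t $ l"], of "norm e"]
        by simp
      moreover have "lo * norm (g t $ l) - lo * norm e \<le> lo * norm (N t $ l)"
        using norm_triangle_ineq4[of "N t $ l" e] mult_left_mono[OF _ lo, of "norm (g t $ l)" "norm (N t $ l) + norm e"]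
        by (simp add: e_def algebra_simps)
      moreover have "g t $ l \<bullet> orth (N t $ l) = N t $ l \<bullet> orth (N t $ l) - e \<bullet> orth (N t $ l)"
        by (simp add: e_def inner_diff_left)
      ultimately have "lo * norm (g t $ l) - (lo + u) * norm e \<le> g t $ l \<bullet> orth (N t $ l)"
        using orth_inner[of "N t $ l"] by (simp add: algebra_simps)
      moreover have "(lo + u) * norm e \<le> (lo + u) * (\<beta>2 * norm (b t $ l) + norm (W t $ l))"
        using e lo u by (intro mult_left_mono) auto
      ultimately show ?thesis by linarith
    qed
    then have "(\<Sum>l\<in>UNIV. lo * norm (g t $ l) - (lo + u) * (\<beta>2 * norm (b t $ l) + norm (W t $ l)))
        \<le> (\<Sum>l\<in>UNIV. g t $ l \<bullet> orth (N t $ l))"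
      by (intro sum_mono)
    then have "lo * gs t - (lo + u) * (\<beta>2 * bs t + Ws t) \<le> (\<Sum>l\<in>UNIV. g t $ l \<bullet> orth (N t $ l))"
      by (simp add: gs_def bs_def Ws_def sum_subtractf sum.distrib sum_distrib_left[symmetric])
    also have "\<dots> \<le> (F (X t) - F (X (t + 1)) + (\<kappa> + q * L1 * gs t) / 2 * (\<gamma>\<^sup>2 * u\<^sup>2 * L)) / \<gamma>"
      using 1 params by (simp add: pos_le_divide_eq mult.commute)
    also have "\<dots> = (F (X t) - F (X (t + 1))) / \<gamma> + \<gamma> * L * u\<^sup>2 / 2 * (\<kappa> + q * L1 * gs t)"
      using params by (simp add: field_simps power2_eq_square)
    finally show ?thesis by linarith
  qed
  have bias: "\<delta> * (\<Sum>t=1..T. bs t) \<le> gs 1 + \<gamma> * L * u * (real T * \<kappa> + q * L1 * (\<Sum>t=1..T. gs t))"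
  proof -
    define y where "y t = (\<Sum>l\<in>UNIV. norm ((g (max 1 t) - g (Suc t)) $ l))" for t
    have rec: "bs (Suc t) \<le> \<beta>1 * (bs t + y t)" for t
    proof -
      have "bs (Suc t) \<le> (\<Sum>l\<in>UNIV. \<beta>1 * (norm (b t $ l) + norm ((g (max 1 t) - g (Suc t)) $ l)))"
        unfolding bs_def
      proof (rule sum_mono)
        fix l
        have "b (Suc t) $ l = \<beta>1 *\<^sub>R (b t $ l + (g (max 1 t) - g (Suc t)) $ l)"
          by (simp add: b_def)
        then show "norm (b (Suc t) $ l) \<le> \<beta>1 * (norm (b t $ l) + norm ((g (max 1 t) - g (Suc t)) $ l))"
          using params norm_triangle_ineq[of "b t $ l" "(g (max 1 t) - g (Suc t)) $ l"]
          by (simp add: mult_left_mono del: vector_minus_component)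
      qed
      also have "\<dots> = \<beta>1 * (bs t + y t)"
        by (simp add: bs_def y_def sum_distrib_left[symmetric] sum.distrib)
      finally show ?thesis .
    qed
    have y0: "0 \<le> y t" for t by (simp add: y_def sum_nonneg)
    have "\<delta> * (\<Sum>t=1..T. bs t) \<le> bs 0 + (\<Sum>t<T. y t)"
      unfolding \<delta>_def using params by (intro damped_recursion_sum rec y0 bs0) auto
    also have "bs 0 = gs 1" by (simp add: bs_def gs_def b_def)
    \<comment> \<open>The term at \<open>0\<close> vanishes by the convention that identifies the
      gradient before the first step with the first gradient. The nonnegative term at
      \<open>T\<close> is added so that the range agrees with that of the gradient norms.\<close>
    also have "(\<Sum>t<T. y t) \<le> (\<Sum>t\<in>{1..T}. y t)"
    proof -
      have "y 0 = 0" by (simp add: y_def)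
      then have "(\<Sum>t<T. y t) = (\<Sum>t\<in>{1..<T}. y t)"
        by (intro sum.mono_neutral_right) (auto simp: not_less_eq_eq intro: le_antisym)
      also have "\<dots> \<le> (\<Sum>t\<in>{1..T}. y t)" using y0 by (intro sum_mono2) auto
      finally show ?thesis .
    qed
    also have "(\<Sum>t=1..T. y t) \<le> (\<Sum>t=1..T. \<gamma> * L * u * (\<kappa> + q * L1 * gs t))"
    proof (rule sum_mono)
      fix t assume t: "t \<in> {1..T}"
      then have xt: "X t \<in> S" "X (t + 1) \<in> S" using XS by auto
      have "y t \<le> sqrt L * norm (g t - g (t + 1))"
        using sum_norm_nth_le[of "g t - g (t + 1)"] t by (simp add: y_def L_def max_absorb2)
      \<comment> \<open>The local constant is taken at the earlier point, so that the gradient norm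
        it contains is one of those being summed.\<close>
      also have "norm (g t - g (t + 1)) \<le> (\<kappa> + q * L1 * norm (g t)) * norm (X t - X (t + 1))"
        unfolding g_def \<kappa>_def by (rule joint_smooth_on_affine[OF smooth const(2-4) xt])
      also have "\<dots> \<le> (\<kappa> + q * L1 * gs t) * (\<gamma> * u * sqrt L)"
        using K[of t] dX[OF t] \<kappa> qL1 gs0[of t]
        by (intro mult_mono) (auto simp: norm_minus_commute)
      also have "sqrt L * ((\<kappa> + q * L1 * gs t) * (\<gamma> * u * sqrt L))
          = \<gamma> * (sqrt L * sqrt L) * u * (\<kappa> + q * L1 * gs t)"
        by (simp add: mult_ac)
      also have "sqrt L * sqrt L = L" using L by simp
      finally show "y t \<le> \<gamma> * L * u * (\<kappa> + q * L1 * gs t)" using L by (simp add: mult_left_mono)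
    qed
    also have "\<dots> = \<gamma> * L * u * (real T * \<kappa> + q * L1 * (\<Sum>t=1..T. gs t))"
      by (simp add: sum_distrib_left[symmetric] sum.distrib)
    finally show ?thesis by linarith
  qed
  define g\<Sigma> where "g\<Sigma> = (\<Sum>t=1..T. gs t)"
  define b\<Sigma> where "b\<Sigma> = (\<Sum>t=1..T. bs t)"
  define W\<Sigma> where "W\<Sigma> = (\<Sum>t=1..T. Ws t)"
  have g\<Sigma>0: "0 \<le> g\<Sigma>" unfolding g\<Sigma>_def using gs0 by (simp add: sum_nonneg)
  have tele: "(\<Sum>t=1..T. F (X t) - F (X (t + 1))) = F (X 1) - F (X (T + 1))"
    by (induction T) simp_all
  have "lo * g\<Sigma> \<le> (\<Sum>t=1..T. (F (X t) - F (X (t + 1))) / \<gamma> + (lo + u) * (\<beta>2 * bs t + Ws t)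
      + \<gamma> * L * u\<^sup>2 / 2 * (\<kappa> + q * L1 * gs t))"
    unfolding g\<Sigma>_def sum_distrib_left by (intro sum_mono descent)
  also have "\<dots> = (F (X 1) - F (X (T + 1))) / \<gamma> + (lo + u) * (\<beta>2 * b\<Sigma> + W\<Sigma>)
      + \<gamma> * L * u\<^sup>2 / 2 * (real T * \<kappa> + q * L1 * g\<Sigma>)"
    using tele by (simp add: sum.distrib sum_distrib_left[symmetric] sum_divide_distrib[symmetric]
        g\<Sigma>_def b\<Sigma>_def W\<Sigma>_def)
  also have "(F (X 1) - F (X (T + 1))) / \<gamma> \<le> (F (X 1) - Fstar) / \<gamma>"
    using lower XS[of "T + 1"] params by (intro divide_right_mono) auto
  also have "\<beta>2 * b\<Sigma> \<le> \<beta>2 * gs 1 / \<delta> + \<gamma> * \<beta>2 * L * u * (real T * \<kappa>) / \<delta> + \<gamma> * L * u * (q * L1 * g\<Sigma>) / \<delta>"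
  proof -
    have "b\<Sigma> \<le> (gs 1 + \<gamma> * L * u * (real T * \<kappa> + q * L1 * g\<Sigma>)) / \<delta>"
      using bias \<delta> by (simp add: pos_le_divide_eq mult.commute b\<Sigma>_def g\<Sigma>_def)
    then have "\<beta>2 * b\<Sigma> \<le> \<beta>2 * ((gs 1 + \<gamma> * L * u * (real T * \<kappa> + q * L1 * g\<Sigma>)) / \<delta>)"
      using params by (intro mult_left_mono) auto
    also have "\<dots> = \<beta>2 * gs 1 / \<delta> + \<gamma> * \<beta>2 * L * u * (real T * \<kappa>) / \<delta>
        + \<beta>2 * (\<gamma> * L * u * (q * L1 * g\<Sigma>) / \<delta>)"
      by (simp add: add_divide_distrib algebra_simps)
    \<comment> \<open>Only in the part proportional to the gradient norms is \<open>\<beta>2\<close>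
      bounded by one; this is why it is absent from \<Delta> but present in the remaining bias
      terms.\<close>
    also have "\<beta>2 * (\<gamma> * L * u * (q * L1 * g\<Sigma>) / \<delta>) \<le> 1 * (\<gamma> * L * u * (q * L1 * g\<Sigma>) / \<delta>)"
      using params L u qL1 g\<Sigma>0 \<delta> by (intro mult_right_mono) auto
    finally show ?thesis by simp
  qed
  finally have "lo * g\<Sigma> \<le> (F (X 1) - Fstar) / \<gamma>
      + (lo + u) * (\<beta>2 * gs 1 / \<delta> + \<gamma> * \<beta>2 * L * u * (real T * \<kappa>) / \<delta> + \<gamma> * L * u * (q * L1 * g\<Sigma>) / \<delta> + W\<Sigma>)
      + \<gamma> * L * u\<^sup>2 / 2 * (real T * \<kappa> + q * L1 * g\<Sigma>)"
    using lo u by (simp add: mult_left_mono)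
  then have "(lo - \<gamma> * L * u\<^sup>2 * q * L1 / 2 - \<gamma> * L * u * (lo + u) * q * L1 / \<delta>) * g\<Sigma>
      \<le> (F (X 1) - Fstar) / \<gamma> + \<beta>2 * (lo + u) * gs 1 / \<delta> + (lo + u) * W\<Sigma>
        + real T * (\<gamma> * \<beta>2 * L * u * (lo + u) * \<kappa> / \<delta> + \<gamma> * L * u\<^sup>2 * \<kappa> / 2)"
    by (simp add: algebra_simps add_divide_distrib)
  then show ?thesis
    by (simp add: g\<Sigma>_def W\<Sigma>_def gs_def Ws_def W_def \<delta>_def)
qed

subsection \<open>Second moments of the noise\<close>

lemma borel_measurable_vec_nth [measurable (raw)]:
  fixes f :: "'x \<Rightarrow> 'a::euclidean_space ^ 'l"
  assumes "f \<in> borel_measurable M"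
  shows "(\<lambda>x. f x $ l) \<in> borel_measurable M"
proof -
  have "(\<lambda>v :: 'a ^ 'l. v $ l) \<in> borel_measurable borel"
    by (intro borel_measurable_continuous_onI continuous_intros)
  from measurable_compose[OF assms this] show ?thesis .
qed

lemma continuous_on_If_const:
  "continuous_on A f \<Longrightarrow> continuous_on A g \<Longrightarrow> continuous_on A (\<lambda>x. if b then f x else g x)"
  by (cases b) simp_all

lemma borel_measurable_vec_lambda:
  fixes f :: "'l::finite \<Rightarrow> 'x \<Rightarrow> 'a::euclidean_space"
  assumes "\<And>l. f l \<in> borel_measurable M"
  shows "(\<lambda>x. \<chi> l. f l x) \<in> borel_measurable M"
proof -
  have "(\<lambda>y :: 'a. axis l y) \<in> borel_measurable borel" for l :: 'l
    unfolding axis_def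
    by (intro borel_measurable_continuous_onI continuous_on_vec_lambda)
      (intro continuous_on_If_const continuous_intros)
  then have "(\<lambda>x. \<Sum>l\<in>UNIV. axis l (f l x)) \<in> borel_measurable M"
    using assms by (intro borel_measurable_sum) (rule measurable_compose)
  moreover have "(\<Sum>l\<in>UNIV. axis l (f l x)) = (\<chi> l. f l x)" for x
    by (simp add: vec_eq_iff axis_def)
  ultimately show ?thesis by simp
qed

text \<open>Independence of two families of events is turned into a product law, the form in which
  Fubini can integrate out the sample. Comparing the two measures on rectangles is enough.\<close>

lemma (in prob_space) indep_set_distr_pair:
  assumes indep: "indep_set H (sample_events M P Z)" and H: "sigma_algebra (space M) H"
    and Y: "Y \<in> measurable (sigma (space M) H) N"
    and Z: "Z \<in> measurable M P"
  shows "distr M (N \<Otimes>\<^sub>M P) (\<lambda>\<omega>. (Y \<omega>, Z \<omega>)) = distr M N Y \<Otimes>\<^sub>M distr M P Z"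
proof -
  interpret H: sigma_algebra "space M" H by fact
  have HM: "H \<subseteq> sets M"
    using indep by (auto simp: indep_set_def indep_sets_def split: bool.splits)
  have sets_H: "sets (sigma (space M) H) = H" by (rule H.sets_measure_of_eq)
  have Y': "Y \<in> measurable M N"
    using Y HM sets_H by (auto simp: measurable_def)
  have Y_sets: "Y -` A \<inter> space M \<in> H" if "A \<in> sets N" for A
    using measurable_sets[OF Y that] sets_H by simp
  interpret Y: prob_space "distr M N Y" using Y' by (rule prob_space_distr)
  interpret Z: prob_space "distr M P Z" using Z by (rule prob_space_distr)
  show ?thesis
  proof (rule pair_measure_eqI[symmetric])
    fix A B assume "A \<in> sets (distr M N Y)" "B \<in> sets (distr M P Z)"
    then have A: "A \<in> sets N" and B: "B \<in> sets P" by auto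
    have "prob ((Y -` A \<inter> space M) \<inter> (Z -` B \<inter> space M))
        = prob (Y -` A \<inter> space M) * prob (Z -` B \<inter> space M)"
      using indep_setD[OF indep Y_sets[OF A]] B by (auto simp: sample_events_def)
    moreover have "(\<lambda>\<omega>. (Y \<omega>, Z \<omega>)) -` (A \<times> B) \<inter> space M
        = (Y -` A \<inter> space M) \<inter> (Z -` B \<inter> space M)" by auto
    ultimately show "emeasure (distr M N Y) A * emeasure (distr M P Z) B
        = emeasure (distr M (N \<Otimes>\<^sub>M P) (\<lambda>\<omega>. (Y \<omega>, Z \<omega>))) (A \<times> B)"
      using A B Y' Z by (simp add: emeasure_distr emeasure_eq_measure ennreal_mult)
  next
    show "sets (distr M N Y \<Otimes>\<^sub>M distr M P Z)
        = sets (distr M (N \<Otimes>\<^sub>M P) (\<lambda>\<omega>. (Y \<omega>, Z \<omega>)))"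
      unfolding sets_distr by (intro sets_pair_measure_cong sets_distr)
  qed (rule Y.sigma_finite_measure_axioms Z.sigma_finite_measure_axioms)+
qed

text \<open>
  Everything that is known before the sample \<open>Z\<close> is drawn enters as a random variable \<open>Y\<close>, so
  conditioning on the past is integration over \<open>Z\<close> with \<open>Y\<close> fixed.
\<close>

lemma (in prob_space) fresh_sample_noise:
  fixes h :: "'y \<Rightarrow> 'z \<Rightarrow> 'e::euclidean_space" and w :: "'y \<Rightarrow> 'e"
  assumes P: "prob_space P" and Y: "Y \<in> measurable M N" and Z: "Z \<in> measurable M P"
    and law: "distr M (N \<Otimes>\<^sub>M P) (\<lambda>\<omega>. (Y \<omega>, Z \<omega>)) = distr M N Y \<Otimes>\<^sub>M P"
    and h: "(\<lambda>(y, z). h y z) \<in> borel_measurable (N \<Otimes>\<^sub>M P)"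
    and sq: "\<And>y. y \<in> space N \<Longrightarrow> integrable P (\<lambda>z. (norm (h y z))\<^sup>2)"
      "\<And>y. y \<in> space N \<Longrightarrow> (LINT z|P. (norm (h y z))\<^sup>2) \<le> s\<^sup>2"
    and mean: "\<And>y. y \<in> space N \<Longrightarrow> integrable P (h y)"
      "\<And>y. y \<in> space N \<Longrightarrow> (LINT z|P. h y z) = 0"
    and w: "w \<in> borel_measurable N"
  shows "integrable M (\<lambda>\<omega>. (norm (h (Y \<omega>) (Z \<omega>)))\<^sup>2)"
    and "(LINT \<omega>|M. (norm (h (Y \<omega>) (Z \<omega>)))\<^sup>2) \<le> s\<^sup>2"
    and "integrable M (\<lambda>\<omega>. (norm (w (Y \<omega>)))\<^sup>2) \<Longrightarrow>
      integrable M (\<lambda>\<omega>. w (Y \<omega>) \<bullet> h (Y \<omega>) (Z \<omega>)) \<and> (LINT \<omega>|M. w (Y \<omega>) \<bullet> h (Y \<omega>) (Z \<omega>)) = 0"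
proof -
  interpret P: prob_space P by fact
  interpret Q: prob_space "distr M N Y" using Y by (rule prob_space_distr)
  interpret QP: pair_sigma_finite "distr M N Y" P ..
  let ?D = "distr M N Y"
  have pair[measurable]: "(\<lambda>\<omega>. (Y \<omega>, Z \<omega>)) \<in> measurable M (N \<Otimes>\<^sub>M P)" using Y Z by simp
  have sets_eq: "sets (?D \<Otimes>\<^sub>M P) = sets (N \<Otimes>\<^sub>M P)" by (intro sets_pair_measure_cong) auto
  note [measurable] = h w Y Z
  have hM: "(\<lambda>\<omega>. h (Y \<omega>) (Z \<omega>)) \<in> borel_measurable M"
    using measurable_compose[OF pair h] by simp
  \<comment> \<open>Nonnegative integrals come first, because square integrability of the composed
    noise is itself part of the claim.\<close>
  have "(\<integral>\<^sup>+\<omega>. ennreal ((norm (h (Y \<omega>) (Z \<omega>)))\<^sup>2) \<partial>M)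
      = (\<integral>\<^sup>+p. ennreal ((norm (h (fst p) (snd p)))\<^sup>2) \<partial>(?D \<Otimes>\<^sub>M P))"
    unfolding law[symmetric] using h by (subst nn_integral_distr) (auto simp: case_prod_beta)
  also have "\<dots> = (\<integral>\<^sup>+y. \<integral>\<^sup>+z. ennreal ((norm (h y z))\<^sup>2) \<partial>P \<partial>?D)"
    using h by (subst P.nn_integral_fst[symmetric]) (auto simp: case_prod_beta measurable_cong_sets[OF sets_eq refl])
  also have "\<dots> \<le> (\<integral>\<^sup>+y. ennreal (s\<^sup>2) \<partial>?D)"
    using sq by (intro nn_integral_mono) (auto simp: nn_integral_eq_integral intro!: ennreal_leI)
  also have "\<dots> = ennreal (s\<^sup>2)" by (simp add: Q.emeasure_space_1[unfolded space_distr])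
  finally have nn: "(\<integral>\<^sup>+\<omega>. ennreal ((norm (h (Y \<omega>) (Z \<omega>)))\<^sup>2) \<partial>M) \<le> ennreal (s\<^sup>2)" .
  show int_h: "integrable M (\<lambda>\<omega>. (norm (h (Y \<omega>) (Z \<omega>)))\<^sup>2)"
    using hM nn by (intro integrableI_bounded) (auto simp: order_le_less_trans[OF _ ennreal_less_top])
  then show "(LINT \<omega>|M. (norm (h (Y \<omega>) (Z \<omega>)))\<^sup>2) \<le> s\<^sup>2"
    using nn by (simp add: nn_integral_eq_integral)
  assume int_w: "integrable M (\<lambda>\<omega>. (norm (w (Y \<omega>)))\<^sup>2)"
  have wM: "(\<lambda>\<omega>. w (Y \<omega>)) \<in> borel_measurable M" by measurable
  have int: "integrable M (\<lambda>\<omega>. w (Y \<omega>) \<bullet> h (Y \<omega>) (Z \<omega>))"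
  proof (rule Bochner_Integration.integrable_bound)
    show "integrable M (\<lambda>\<omega>. (norm (w (Y \<omega>)))\<^sup>2 + (norm (h (Y \<omega>) (Z \<omega>)))\<^sup>2)"
      using int_w int_h by simp
    show "(\<lambda>\<omega>. w (Y \<omega>) \<bullet> h (Y \<omega>) (Z \<omega>)) \<in> borel_measurable M"
      using wM hM by measurable
    have "\<bar>v \<bullet> x\<bar> \<le> (norm v)\<^sup>2 + (norm x)\<^sup>2" for v x :: 'e
      using Cauchy_Schwarz_ineq2[of v x] sum_squares_bound[of "norm v" "norm x"]
        mult_nonneg_nonneg[OF norm_ge_zero[of v] norm_ge_zero[of x]] by linarith
    then show "AE \<omega> in M. norm (w (Y \<omega>) \<bullet> h (Y \<omega>) (Z \<omega>))
        \<le> norm ((norm (w (Y \<omega>)))\<^sup>2 + (norm (h (Y \<omega>) (Z \<omega>)))\<^sup>2)" by simp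
  qed
  have meas: "(\<lambda>p. w (fst p) \<bullet> h (fst p) (snd p)) \<in> borel_measurable (N \<Otimes>\<^sub>M P)"
    using h by (intro borel_measurable_inner) (auto simp: case_prod_beta)
  \<comment> \<open>Integrability on the product space licenses Fubini. For fixed \<open>y\<close>
    the vector \<open>w y\<close> is constant, so the inner integral is its pairing with the mean of
    the noise, which is zero.\<close>
  have "integrable (?D \<Otimes>\<^sub>M P) (\<lambda>p. w (fst p) \<bullet> h (fst p) (snd p))"
    unfolding law[symmetric] using int by (subst integrable_distr_eq[OF pair meas]) simp
  then have "(LINT p|(?D \<Otimes>\<^sub>M P). w (fst p) \<bullet> h (fst p) (snd p)) = (LINT y|?D. LINT z|P. w y \<bullet> h y z)"
    by (subst QP.integral_fst'[symmetric]) auto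
  also have "\<dots> = (LINT y|?D. 0)"
    using mean by (intro Bochner_Integration.integral_cong) auto
  finally have "(LINT p|(distr M (N \<Otimes>\<^sub>M P) (\<lambda>\<omega>. (Y \<omega>, Z \<omega>))). w (fst p) \<bullet> h (fst p) (snd p)) = 0"
    by (simp add: law)
  then have "(LINT \<omega>|M. w (Y \<omega>) \<bullet> h (Y \<omega>) (Z \<omega>)) = 0"
    by (subst (asm) integral_distr[OF pair meas]) simp
  with int show "integrable M (\<lambda>\<omega>. w (Y \<omega>) \<bullet> h (Y \<omega>) (Z \<omega>)) \<and>
      (LINT \<omega>|M. w (Y \<omega>) \<bullet> h (Y \<omega>) (Z \<omega>)) = 0" by simp
qed

lemma norm_sq_lin_comb:
  fixes x y :: "'a::real_inner"
  shows "(norm (r *\<^sub>R x + s *\<^sub>R y))\<^sup>2 = r\<^sup>2 * (norm x)\<^sup>2 + s\<^sup>2 * (norm y)\<^sup>2 + 2 * r * s * (x \<bullet> y)"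
  unfolding power2_norm_eq_inner
  by (simp add: inner_add inner_commute power2_eq_square algebra_simps)

lemma second_moment_orthogonal_lin_comb:
  fixes x y :: "'w \<Rightarrow> 'e::real_inner"
  assumes x: "integrable M (\<lambda>\<omega>. (norm (x \<omega>))\<^sup>2)" and y: "integrable M (\<lambda>\<omega>. (norm (y \<omega>))\<^sup>2)"
    and xy: "integrable M (\<lambda>\<omega>. x \<omega> \<bullet> y \<omega>) \<and> (LINT \<omega>|M. x \<omega> \<bullet> y \<omega>) = 0"
  shows "integrable M (\<lambda>\<omega>. (norm (r *\<^sub>R x \<omega> + s *\<^sub>R y \<omega>))\<^sup>2)"
    "(LINT \<omega>|M. (norm (r *\<^sub>R x \<omega> + s *\<^sub>R y \<omega>))\<^sup>2)
      = r\<^sup>2 * (LINT \<omega>|M. (norm (x \<omega>))\<^sup>2) + s\<^sup>2 * (LINT \<omega>|M. (norm (y \<omega>))\<^sup>2)"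
  using assms by (simp_all add: norm_sq_lin_comb)

context
  fixes M :: "'w measure" and n :: "nat \<Rightarrow> 'w \<Rightarrow> 'e::euclidean_space" and \<beta>1 \<beta>2 s :: real and T :: nat
  assumes sq: "\<And>t. t \<in> {1..T} \<Longrightarrow> integrable M (\<lambda>\<omega>. (norm (n t \<omega>))\<^sup>2)"
      "\<And>t. t \<in> {1..T} \<Longrightarrow> (LINT \<omega>|M. (norm (n t \<omega>))\<^sup>2) \<le> s\<^sup>2"
    and orth: "\<And>t. t \<in> {1..T} \<Longrightarrow>
      integrable M (\<lambda>\<omega>. (norm (momentum_noise \<beta>1 (\<lambda>t. n t \<omega>) (t - 1)))\<^sup>2) \<Longrightarrow>
      integrable M (\<lambda>\<omega>. momentum_noise \<beta>1 (\<lambda>t. n t \<omega>) (t - 1) \<bullet> n t \<omega>) \<and>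
      (LINT \<omega>|M. momentum_noise \<beta>1 (\<lambda>t. n t \<omega>) (t - 1) \<bullet> n t \<omega>) = 0"
    and \<beta>: "0 \<le> \<beta>1" "\<beta>1 < 1" "0 \<le> \<beta>2" "\<beta>2 \<le> 1"
begin

text \<open>The bound is the fixed point of the recursion sending \<open>A\<close> to
  \<open>\<beta>1\<^sup>2 * A + (1 - \<beta>1)\<^sup>2 * s\<^sup>2\<close>. Integrability belongs to
  the same induction, since the cross term is known to vanish only once the preceding average is
  square integrable.\<close>

lemma momentum_noise_second_moment:
  "t \<le> T \<Longrightarrow> integrable M (\<lambda>\<omega>. (norm (momentum_noise \<beta>1 (\<lambda>t. n t \<omega>) t))\<^sup>2) \<and>
     (LINT \<omega>|M. (norm (momentum_noise \<beta>1 (\<lambda>t. n t \<omega>) t))\<^sup>2) \<le> s\<^sup>2 * (1 - \<beta>1) / (1 + \<beta>1)"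
proof (induction t)
  case 0
  then show ?case using \<beta> by simp
next
  case (Suc t)
  define A where "A = (LINT \<omega>|M. (norm (momentum_noise \<beta>1 (\<lambda>t. n t \<omega>) t))\<^sup>2)"
  have t: "Suc t \<in> {1..T}" and IH: "integrable M (\<lambda>\<omega>. (norm (momentum_noise \<beta>1 (\<lambda>t. n t \<omega>) t))\<^sup>2)"
    "A \<le> s\<^sup>2 * (1 - \<beta>1) / (1 + \<beta>1)" using Suc by (auto simp: A_def)
  note moment = second_moment_orthogonal_lin_comb[OF IH(1) sq(1)[OF t], of \<beta>1 "1 - \<beta>1"]
  have xy: "integrable M (\<lambda>\<omega>. momentum_noise \<beta>1 (\<lambda>t. n t \<omega>) t \<bullet> n (Suc t) \<omega>) \<and>
      (LINT \<omega>|M. momentum_noise \<beta>1 (\<lambda>t. n t \<omega>) t \<bullet> n (Suc t) \<omega>) = 0"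
    using orth[OF t] IH(1) by simp
  have "\<beta>1\<^sup>2 * A + (1 - \<beta>1)\<^sup>2 * (LINT \<omega>|M. (norm (n (Suc t) \<omega>))\<^sup>2)
      \<le> \<beta>1\<^sup>2 * (s\<^sup>2 * (1 - \<beta>1) / (1 + \<beta>1)) + (1 - \<beta>1)\<^sup>2 * s\<^sup>2"
    using IH(2) sq(2)[OF t] by (intro add_mono mult_left_mono) auto
  also have "\<dots> = s\<^sup>2 * (1 - \<beta>1) / (1 + \<beta>1)"
  proof -
    define d where "d = (1 - \<beta>1) / (1 + \<beta>1)"
    have sq_eq: "(1 - \<beta>1)\<^sup>2 = (1 - \<beta>1) * (d * (1 + \<beta>1))"
      using \<beta> by (simp add: d_def power2_eq_square)
    have "\<beta>1\<^sup>2 * (s\<^sup>2 * d) + (1 - \<beta>1)\<^sup>2 * s\<^sup>2 = s\<^sup>2 * d"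
      by (simp only: sq_eq) (simp add: power2_eq_square algebra_simps)
    then show ?thesis by (simp add: d_def)
  qed
  finally show ?case using moment[OF xy] by (simp add: A_def)
qed

text \<open>Past and fresh noise contribute the squares of their weights. Their total is at most
  \<open>s\<^sup>2\<close> times a sum of two nonnegative terms, and a sum of nonnegative numbers is
  at most the square of the sum of their roots; these roots are the two summands of the
  constant.\<close>

lemma nesterov_noise_second_moment:
  assumes t: "t \<in> {1..T}"
  shows "integrable M (\<lambda>\<omega>. (norm (nesterov_noise \<beta>1 \<beta>2 (\<lambda>t. n t \<omega>) t))\<^sup>2)"
    "(LINT \<omega>|M. (norm (nesterov_noise \<beta>1 \<beta>2 (\<lambda>t. n t \<omega>) t))\<^sup>2)
      \<le> (s * (sqrt (1 - \<beta>1) + sqrt (2 * \<beta>1 * (1 - \<beta>1 * \<beta>2) * (1 - \<beta>2))))\<^sup>2"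
proof -
  have "t - 1 \<le> T" using t by auto
  note w = momentum_noise_second_moment[OF this]
  define A where "A = (LINT \<omega>|M. (norm (momentum_noise \<beta>1 (\<lambda>t. n t \<omega>) (t - 1)))\<^sup>2)"
  note moment = second_moment_orthogonal_lin_comb[OF conjunct1[OF w] sq(1)[OF t] orth[OF t conjunct1[OF w]],
      of "\<beta>2 * \<beta>1" "1 - \<beta>1 * \<beta>2"]
  show "integrable M (\<lambda>\<omega>. (norm (nesterov_noise \<beta>1 \<beta>2 (\<lambda>t. n t \<omega>) t))\<^sup>2)"
    unfolding nesterov_noise_def by (rule moment(1))
  have "(LINT \<omega>|M. (norm (nesterov_noise \<beta>1 \<beta>2 (\<lambda>t. n t \<omega>) t))\<^sup>2)
      = (\<beta>2 * \<beta>1)\<^sup>2 * A + (1 - \<beta>1 * \<beta>2)\<^sup>2 * (LINT \<omega>|M. (norm (n t \<omega>))\<^sup>2)"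
    unfolding nesterov_noise_def A_def by (rule moment(2))
  also have "\<dots> \<le> (\<beta>2 * \<beta>1)\<^sup>2 * (s\<^sup>2 * (1 - \<beta>1) / (1 + \<beta>1)) + (1 - \<beta>1 * \<beta>2)\<^sup>2 * s\<^sup>2"
    using w sq(2)[OF t] by (intro add_mono mult_left_mono) (auto simp: A_def)
  also have "\<dots> = s\<^sup>2 * (\<beta>2\<^sup>2 * (\<beta>1\<^sup>2 * ((1 - \<beta>1) / (1 + \<beta>1))) + (1 - \<beta>1 * \<beta>2)\<^sup>2)"
    by (simp add: power_mult_distrib algebra_simps)
  also have "\<dots> \<le> s\<^sup>2 * ((1 - \<beta>1) + 2 * \<beta>1 * (1 - \<beta>1 * \<beta>2) * (1 - \<beta>2))"
  proof (rule mult_left_mono)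
    have "(1 - \<beta>1) / (1 + \<beta>1) \<le> 1 - \<beta>1"
      using \<beta> mult_left_mono[of 1 "1 + \<beta>1" "1 - \<beta>1"] by (simp add: pos_divide_le_eq)
    then have "\<beta>2\<^sup>2 * (\<beta>1\<^sup>2 * ((1 - \<beta>1) / (1 + \<beta>1))) \<le> 1 * (\<beta>1\<^sup>2 * (1 - \<beta>1))"
      using \<beta> by (intro mult_mono mult_left_mono) (auto simp: power_le_one)
    moreover have "\<beta>1\<^sup>2 * (1 - \<beta>1) \<le> \<beta>1 * (1 - \<beta>1)"
      using \<beta> by (intro mult_right_mono) (auto simp: power2_eq_square mult_left_le_one_le)
    \<comment> \<open>An exact identity: the target exceeds the two contributions, the first
      enlarged to \<open>\<beta>1 * (1 - \<beta>1)\<close>, by the square of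
      \<open>\<beta>1 * (1 - \<beta>2)\<close>, which is dropped.\<close>
    moreover have "(1 - \<beta>1) + 2 * \<beta>1 * (1 - \<beta>1 * \<beta>2) * (1 - \<beta>2)
        = \<beta>1 * (1 - \<beta>1) + (\<beta>1 * (1 - \<beta>2))\<^sup>2 + (1 - \<beta>1 * \<beta>2)\<^sup>2"
      by (simp add: power2_eq_square algebra_simps)
    ultimately show "\<beta>2\<^sup>2 * (\<beta>1\<^sup>2 * ((1 - \<beta>1) / (1 + \<beta>1))) + (1 - \<beta>1 * \<beta>2)\<^sup>2
        \<le> (1 - \<beta>1) + 2 * \<beta>1 * (1 - \<beta>1 * \<beta>2) * (1 - \<beta>2)"
      using zero_le_power2[of "\<beta>1 * (1 - \<beta>2)"] by linarith
  qed simp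
  also have "\<dots> \<le> (s * (sqrt (1 - \<beta>1) + sqrt (2 * \<beta>1 * (1 - \<beta>1 * \<beta>2) * (1 - \<beta>2))))\<^sup>2"
  proof -
    have "\<beta>1 * \<beta>2 \<le> 1" using \<beta> by (simp add: mult_le_one)
    then have "0 \<le> 2 * \<beta>1 * (1 - \<beta>1 * \<beta>2) * (1 - \<beta>2)" using \<beta> by simp
    then show ?thesis
      using \<beta> by (auto simp: power_mult_distrib power2_sum intro!: mult_left_mono)
  qed
  finally show "(LINT \<omega>|M. (norm (nesterov_noise \<beta>1 \<beta>2 (\<lambda>t. n t \<omega>) t))\<^sup>2)
      \<le> (s * (sqrt (1 - \<beta>1) + sqrt (2 * \<beta>1 * (1 - \<beta>1 * \<beta>2) * (1 - \<beta>2))))\<^sup>2" .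
qed

end

text \<open>Jensen's inequality for the square, in the form that a variance is nonnegative.\<close>

lemma (in prob_space) expectation_norm_le_of_second_moment:
  fixes Y :: "'a \<Rightarrow> 'e::euclidean_space"
  assumes Y: "Y \<in> borel_measurable M" "integrable M (\<lambda>\<omega>. (norm (Y \<omega>))\<^sup>2)"
    and le: "(LINT \<omega>|M. (norm (Y \<omega>))\<^sup>2) \<le> c\<^sup>2" and c: "0 \<le> c"
  shows "integrable M (\<lambda>\<omega>. norm (Y \<omega>))" "(LINT \<omega>|M. norm (Y \<omega>)) \<le> c"
proof -
  show int: "integrable M (\<lambda>\<omega>. norm (Y \<omega>))"
    by (rule square_integrable_imp_integrable) (use Y in simp_all)
  have "0 \<le> (LINT \<omega>|M. (norm (Y \<omega>))\<^sup>2) - (LINT \<omega>|M. norm (Y \<omega>))\<^sup>2"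
    unfolding variance_eq[OF int Y(2), symmetric] by (rule variance_positive)
  with le have "(LINT \<omega>|M. norm (Y \<omega>))\<^sup>2 \<le> c\<^sup>2" by linarith
  then show "(LINT \<omega>|M. norm (Y \<omega>)) \<le> c" using c by (rule power2_le_imp_le)
qed

subsection \<open>Adaptedness of the iterates\<close>

lemma layerwise_muonD:
  assumes "layerwise_muon S f orth \<beta>1 \<beta>2 \<gamma> T Xinit z X Mom"
  defines "G \<equiv> \<lambda>t. grad_on S (\<lambda>Y. f Y (z t)) (X t)"
  shows "X 1 = Xinit" "Mom 0 = 0"
    and "\<And>t. t \<in> {1..T} \<Longrightarrow> Mom t = \<beta>1 *\<^sub>R Mom (t - 1) + (1 - \<beta>1) *\<^sub>R G t"
    and "\<And>t l. t \<in> {1..T} \<Longrightarrow>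
      X (t + 1) $ l = X t $ l - \<gamma> *\<^sub>R orth ((\<beta>2 *\<^sub>R Mom t + (1 - \<beta>2) *\<^sub>R G t) $ l)"
    and "\<And>t. t \<in> {1..T} \<Longrightarrow>
      X (t + 1) = X t - \<gamma> *\<^sub>R (\<chi> l. orth ((\<beta>2 *\<^sub>R Mom t + (1 - \<beta>2) *\<^sub>R G t) $ l))"
  using assms by (auto simp: layerwise_muon_def Let_def vec_eq_iff)

lemma muon_iterates_mem:
  assumes muon: "layerwise_muon S f orth \<beta>1 \<beta>2 \<gamma> T Xinit z X Mom" and S: "subspace S"
    and grad: "\<And>t x. t \<in> {1..T} \<Longrightarrow> x \<in> S \<Longrightarrow> grad_on S (\<lambda>Y. f Y (z t)) x \<in> S"
    and orth: "\<And>N. N \<in> S \<Longrightarrow> (\<chi> l. orth (N $ l)) \<in> S" and init: "Xinit \<in> S"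
  shows "t \<le> T \<Longrightarrow> X (Suc t) \<in> S \<and> Mom t \<in> S"
proof (induction t)
  case 0
  then show ?case using layerwise_muonD(1,2)[OF muon] init S by (simp add: subspace_0)
next
  case (Suc t)
  have t: "Suc t \<in> {1..T}" using Suc.prems by simp
  define G where "G = grad_on S (\<lambda>Y. f Y (z (Suc t))) (X (Suc t))"
  have G: "G \<in> S" unfolding G_def using grad[OF t] Suc by simp
  have "Mom (Suc t) = \<beta>1 *\<^sub>R Mom t + (1 - \<beta>1) *\<^sub>R G"
    using layerwise_muonD(3)[OF muon t] by (simp add: G_def)
  then have M: "Mom (Suc t) \<in> S" using Suc G S by (simp add: subspace_add subspace_scale)
  have "X (Suc (Suc t)) = X (Suc t) - \<gamma> *\<^sub>R (\<chi> l. orth ((\<beta>2 *\<^sub>R Mom (Suc t) + (1 - \<beta>2) *\<^sub>R G) $ l))"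
    using layerwise_muonD(5)[OF muon t] by (simp add: G_def)
  moreover have "(\<chi> l. orth ((\<beta>2 *\<^sub>R Mom (Suc t) + (1 - \<beta>2) *\<^sub>R G) $ l)) \<in> S"
    using M G S by (intro orth subspace_add subspace_scale)
  ultimately have "X (Suc (Suc t)) \<in> S"
    using Suc S by (simp add: subspace_diff subspace_scale)
  with M show ?case by simp
qed

text \<open>Every step has bounded length, so after finitely many steps the iterate lies in a fixed
  ball, whatever the samples were. This deterministic bound later makes the gradient norms
  integrable.\<close>

lemma muon_iterates_bounded:
  fixes X :: "nat \<Rightarrow> real ^ 'c ^ 'r ^ 'l"
  assumes muon: "layerwise_muon S f orth \<beta>1 \<beta>2 \<gamma> T Xinit z X Mom" and \<gamma>: "0 \<le> \<gamma>"
    and orth: "\<And>N. norm (orth N) \<le> u"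
  shows "t \<le> T \<Longrightarrow> norm (X (Suc t) - Xinit) \<le> real t * (\<gamma> * (sqrt (real CARD('l)) * u))"
proof (induction t)
  case 0
  then show ?case using layerwise_muonD(1)[OF muon] by simp
next
  case (Suc t)
  then have t: "Suc t \<in> {1..T}" by simp
  let ?O = "\<chi> l. orth ((\<beta>2 *\<^sub>R Mom (Suc t)
    + (1 - \<beta>2) *\<^sub>R grad_on S (\<lambda>Y. f Y (z (Suc t))) (X (Suc t))) $ l)"
  have eq: "X (Suc (Suc t)) - Xinit = (X (Suc t) - Xinit) - \<gamma> *\<^sub>R ?O"
    using layerwise_muonD(5)[OF muon t] by simp
  have "norm (X (Suc (Suc t)) - Xinit) \<le> norm (X (Suc t) - Xinit) + \<gamma> * norm ?O"
    unfolding eq by (rule order_trans[OF norm_triangle_ineq4]) (use \<gamma> in simp)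
  also have "\<gamma> * norm ?O \<le> \<gamma> * (sqrt (real CARD('l)) * u)"
    using orth by (intro mult_left_mono norm_le_of_nth_le \<gamma>) simp
  finally show ?case using Suc by (simp add: algebra_simps)
qed

text \<open>\<open>H t\<close> stands for the information before the sample at \<open>t\<close> is
  drawn. The iterate \<open>X (Suc t)\<close>, the momentum and the averaged noise up to
  \<open>t\<close> all depend on samples up to \<open>t\<close>, hence the shared index
  \<open>Suc t\<close>. The averaged noise is included because it has to be independent of the next
  sample.\<close>

lemma muon_adapted:
  fixes S :: "(real ^ 'c ^ 'r ^ 'l) set" and H :: "nat \<Rightarrow> 'w measure"
    and f :: "real ^ 'c ^ 'r ^ 'l \<Rightarrow> 'z \<Rightarrow> real" and F :: "real ^ 'c ^ 'r ^ 'l \<Rightarrow> real"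
    and \<xi> :: "nat \<Rightarrow> 'w \<Rightarrow> 'z" and X Mom :: "nat \<Rightarrow> 'w \<Rightarrow> real ^ 'c ^ 'r ^ 'l"
  defines "n \<equiv> \<lambda>\<omega> t. grad_on S (\<lambda>Y. f Y (\<xi> t \<omega>)) (X t \<omega>) - grad_on S F (X t \<omega>)"
  assumes grad: "(\<lambda>(x, z). grad_on S (\<lambda>y. f y z) x) \<in> borel_measurable (restrict_space borel S \<Otimes>\<^sub>M P)"
    and grad_F: "grad_on S F \<in> borel_measurable (restrict_space borel S)"
    and orth: "orth \<in> borel_measurable borel"
    and H: "\<And>t. space (H t) = A" "\<And>t. sets (H t) \<subseteq> sets (H (Suc t))"
    and \<xi>: "\<And>t. t \<in> {1..T} \<Longrightarrow> \<xi> t \<in> measurable (H (Suc t)) P"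
    and XS: "\<And>t \<omega>. t \<le> T \<Longrightarrow> \<omega> \<in> A \<Longrightarrow> X (Suc t) \<omega> \<in> S"
    and muon: "\<And>\<omega>. \<omega> \<in> A \<Longrightarrow> layerwise_muon S f orth \<beta>1 \<beta>2 \<gamma> T Xinit
      (\<lambda>t. \<xi> t \<omega>) (\<lambda>t. X t \<omega>) (\<lambda>t. Mom t \<omega>)"
  shows "t \<le> T \<Longrightarrow> X (Suc t) \<in> measurable (H (Suc t)) (restrict_space borel S) \<and>
    Mom t \<in> borel_measurable (H (Suc t)) \<and>
    (\<lambda>\<omega>. momentum_noise \<beta>1 (n \<omega>) t) \<in> borel_measurable (H (Suc t))"
proof (induction t)
  case 0
  have "X 1 \<in> borel_measurable (H 1) \<longleftrightarrow> (\<lambda>\<omega>. Xinit) \<in> borel_measurable (H 1)"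
    using layerwise_muonD(1)[OF muon] H(1) by (intro measurable_cong) simp
  moreover have "Mom 0 \<in> borel_measurable (H 1) \<longleftrightarrow> (\<lambda>\<omega>. 0 :: real ^ 'c ^ 'r ^ 'l) \<in> borel_measurable (H 1)"
    using layerwise_muonD(2)[OF muon] H(1) by (intro measurable_cong) simp
  ultimately show ?case using XS[of 0] H(1) by (auto simp: measurable_restrict_space2_iff)
next
  case (Suc t)
  let ?H = "H (Suc (Suc t))"
  have t: "Suc t \<in> {1..T}" using Suc.prems by simp
  have up: "h \<in> measurable ?H N" if "h \<in> measurable (H (Suc t)) N" for h :: "'w \<Rightarrow> 'x" and N
    using that H(2)[of "Suc t"] H(1) by (auto simp: measurable_def)
  define G where "G \<omega> = grad_on S (\<lambda>Y. f Y (\<xi> (Suc t) \<omega>)) (X (Suc t) \<omega>)" for \<omega>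
  have X: "X (Suc t) \<in> measurable ?H (restrict_space borel S)"
    and Xb: "X (Suc t) \<in> borel_measurable ?H"
    and Mt: "Mom t \<in> borel_measurable ?H"
    and nt: "(\<lambda>\<omega>. momentum_noise \<beta>1 (n \<omega>) t) \<in> borel_measurable ?H"
    using Suc H(1) by (auto intro!: up simp: measurable_restrict_space2_iff)
  have "(\<lambda>\<omega>. (X (Suc t) \<omega>, \<xi> (Suc t) \<omega>)) \<in> measurable ?H (restrict_space borel S \<Otimes>\<^sub>M P)"
    using X \<xi>[OF t] by (rule measurable_Pair)
  from measurable_compose[OF this grad] have G: "G \<in> borel_measurable ?H"
    unfolding G_def by simp
  have gF: "(\<lambda>\<omega>. grad_on S F (X (Suc t) \<omega>)) \<in> borel_measurable ?H"
    using X grad_F by (rule measurable_compose)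
  have n: "(\<lambda>\<omega>. momentum_noise \<beta>1 (n \<omega>) (Suc t)) \<in> borel_measurable ?H"
  proof -
    have "momentum_noise \<beta>1 (n \<omega>) (Suc t) = \<beta>1 *\<^sub>R momentum_noise \<beta>1 (n \<omega>) t
        + (1 - \<beta>1) *\<^sub>R (G \<omega> - grad_on S F (X (Suc t) \<omega>))" for \<omega>
      by (simp add: n_def G_def)
    then show ?thesis using nt G gF by (simp del: momentum_noise.simps)
  qed
  have "Mom (Suc t) \<in> borel_measurable ?H
      \<longleftrightarrow> (\<lambda>\<omega>. \<beta>1 *\<^sub>R Mom t \<omega> + (1 - \<beta>1) *\<^sub>R G \<omega>) \<in> borel_measurable ?H"
    using layerwise_muonD(3)[OF muon t] H(1) by (intro measurable_cong) (simp add: G_def)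
  then have M: "Mom (Suc t) \<in> borel_measurable ?H" using Mt G by simp
  have "(\<lambda>\<omega>. orth ((\<beta>2 *\<^sub>R Mom (Suc t) \<omega> + (1 - \<beta>2) *\<^sub>R G \<omega>) $ l)) \<in> borel_measurable ?H" for l
    using M G by (intro measurable_compose[OF _ orth] borel_measurable_vec_nth) simp
  then have step: "(\<lambda>\<omega>. X (Suc t) \<omega>
      - \<gamma> *\<^sub>R (\<chi> l. orth ((\<beta>2 *\<^sub>R Mom (Suc t) \<omega> + (1 - \<beta>2) *\<^sub>R G \<omega>) $ l))) \<in> borel_measurable ?H"
    using Xb by (intro borel_measurable_diff borel_measurable_scaleR borel_measurable_const
        borel_measurable_vec_lambda)
  have "X (Suc (Suc t)) \<in> borel_measurable ?H \<longleftrightarrow> (\<lambda>\<omega>. X (Suc t) \<omega>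
      - \<gamma> *\<^sub>R (\<chi> l. orth ((\<beta>2 *\<^sub>R Mom (Suc t) \<omega> + (1 - \<beta>2) *\<^sub>R G \<omega>) $ l))) \<in> borel_measurable ?H"
    using layerwise_muonD(5)[OF muon t] H(1) by (intro measurable_cong) (simp add: G_def)
  with step have "X (Suc (Suc t)) \<in> borel_measurable ?H" by simp
  then have "X (Suc (Suc t)) \<in> measurable ?H (restrict_space borel S)"
    using XS[OF Suc.prems] H(1) by (auto simp: measurable_restrict_space2_iff)
  with M n show ?case by simp
qed

lemma momentum_noise_nth: "momentum_noise \<beta> n t $ l = momentum_noise \<beta> (\<lambda>t. n t $ l) t"
  by (induction t) simp_all

lemma nesterov_noise_nth: "nesterov_noise \<beta>1 \<beta>2 n t $ l = nesterov_noise \<beta>1 \<beta>2 (\<lambda>t. n t $ l) t"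
  by (simp add: nesterov_noise_def momentum_noise_nth)

lemma sigma_algebra_history: "sigma_algebra (space \<Omega>) (history \<Omega> P \<xi> t)"
  unfolding history_def by (rule sigma_algebra_sigma_sets) (auto simp: sample_events_def)

lemma sets_sigma_history: "sets (sigma (space \<Omega>) (history \<Omega> P \<xi> t)) = history \<Omega> P \<xi> t"
  by (rule sigma_algebra.sets_measure_of_eq[OF sigma_algebra_history])

lemma space_sigma_history: "space (sigma (space \<Omega>) (history \<Omega> P \<xi> t)) = space \<Omega>"
  by (rule sigma_algebra.space_measure_of_eq[OF sigma_algebra_history])

subsection \<open>The expected gradient norm\<close>

theorem theorem3p4:
  fixes R :: "'l::finite \<Rightarrow> 'r::finite set" and C :: "'l \<Rightarrow> 'c::finite set"
    and S :: "(real ^ 'c ^ 'r ^ 'l) set"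
    and P :: "'z measure" and f :: "real ^ 'c ^ 'r ^ 'l \<Rightarrow> 'z \<Rightarrow> real"
    and F :: "real ^ 'c ^ 'r ^ 'l \<Rightarrow> real"
    and Fstar L0 L1 q \<beta>1 \<beta>2 \<gamma> :: real and \<sigma> :: "'l \<Rightarrow> real"
    and a b c :: "nat \<Rightarrow> real" and J T :: nat
    and \<Omega> :: "'w measure" and \<xi> :: "nat \<Rightarrow> 'w \<Rightarrow> 'z"
    and Xinit :: "real ^ 'c ^ 'r ^ 'l"
    and X Mom :: "nat \<Rightarrow> 'w \<Rightarrow> real ^ 'c ^ 'r ^ 'l"
    and l\<^sub>J u\<^sub>J L \<delta> D S\<^sub>F G\<^sub>F v\<^sub>\<beta> Lhat \<Delta> :: real
  assumes S: "S = layer_space R C"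
    and data: "prob_space P"
    and f_integrable: "\<forall>X\<in>S. integrable P (f X)"
    and F: "F = expected_objective P f"
    and f_differentiable: "\<forall>z\<in>space P. (\<lambda>X. f X z) differentiable_on S"
    and lower_bounded: "\<forall>X\<in>S. F X \<ge> Fstar"
    and smooth_const: "L0 > 0" "L1 \<ge> 0" "0 \<le> q" "q \<le> 1"
    and smooth: "joint_smooth_on S F L0 L1 q"
    and variance: "layerwise_variance S P f \<sigma>"
    and prob: "prob_space \<Omega>"
    and sample: "\<forall>t\<in>{1..T}. \<xi> t \<in> measurable \<Omega> P \<and> distr \<Omega> P (\<xi> t) = P"
    and indep: "\<forall>t\<in>{1..T}.
      prob_space.indep_set \<Omega> (history \<Omega> P \<xi> t) (sample_events \<Omega> P (\<xi> t))"
    and init: "Xinit \<in> S"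
    and muon: "\<forall>\<omega>\<in>space \<Omega>. layerwise_muon S f (newton_schulz a b c J) \<beta>1 \<beta>2 \<gamma> T Xinit
      (\<lambda>t. \<xi> t \<omega>) (\<lambda>t. X t \<omega>) (\<lambda>t. Mom t \<omega>)"
    and params: "0 \<le> \<beta>1" "\<beta>1 < 1" "0 \<le> \<beta>2" "\<beta>2 \<le> 1" "\<gamma> > 0" "J \<ge> 1" "T \<ge> 1"
    and l\<^sub>J: "l\<^sub>J = ns_lower a b c J" and l\<^sub>J_pos: "l\<^sub>J > 0"
    and u\<^sub>J: "u\<^sub>J = ns_upper a b c J"
    and u\<^sub>J_finite: "bdd_above ((\<lambda>s. ns_scalar a b c J s / s) ` {0<..1})"
    and L: "L = real CARD('l)"
    and \<delta>: "\<delta> = 1 - \<beta>1"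
    and D: "D = F Xinit - Fstar"
    and S\<^sub>F: "S\<^sub>F = (\<Sum>l\<in>UNIV. \<sigma> l)"
    and G\<^sub>F: "G\<^sub>F = (\<Sum>l\<in>UNIV. norm (grad_on S F Xinit $ l))"
    and v\<^sub>\<beta>: "v\<^sub>\<beta> = sqrt \<delta> + sqrt (2 * \<beta>1 * (1 - \<beta>1 * \<beta>2) * (1 - \<beta>2))"
    and Lhat: "Lhat = L0 + (1 - q) * L1"
    and \<Delta>: "\<Delta> = l\<^sub>J - \<gamma> * L * u\<^sub>J\<^sup>2 * q * L1 / 2
                   - \<gamma> * L * u\<^sub>J * (l\<^sub>J + u\<^sub>J) * q * L1 / \<delta>"
  shows "\<Delta> * (1 / real T *
           (\<Sum>t=1..T. \<Sum>l\<in>UNIV. LINT \<omega>|\<Omega>. norm (grad_on S F (X t \<omega>) $ l)))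
         \<le> D / (\<gamma> * real T) + \<beta>2 * (l\<^sub>J + u\<^sub>J) * G\<^sub>F / (real T * \<delta>) + (l\<^sub>J + u\<^sub>J) * v\<^sub>\<beta> * S\<^sub>F
           + \<gamma> * \<beta>2 * L * u\<^sub>J * (l\<^sub>J + u\<^sub>J) * Lhat / \<delta> + \<gamma> * L * u\<^sub>J\<^sup>2 * Lhat / 2"
proof -
  interpret P: prob_space P by (rule data)
  interpret \<Omega>: prob_space \<Omega> by (rule prob)
  define orth where "orth = (newton_schulz a b c J :: real ^ 'c ^ 'r \<Rightarrow> _)"
  define H where "H t = sigma (space \<Omega>) (history \<Omega> P \<xi> t)" for t
  define g where "g t \<omega> = grad_on S F (X t \<omega>)" for t \<omega>
  define n where "n = (\<lambda>\<omega> t. grad_on S (\<lambda>Y. f Y (\<xi> t \<omega>)) (X t \<omega>) - grad_on S F (X t \<omega>))"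
  have subS: "subspace S" unfolding S by (rule subspace_layer_space)
  have lo: "0 < ns_lower a b c J" using l\<^sub>J l\<^sub>J_pos by simp
  have orth_inner: "l\<^sub>J * norm N \<le> N \<bullet> orth N" and orth_norm: "norm (orth N) \<le> u\<^sub>J" for N
    using newton_schulz_bounds[OF lo, of N] by (simp_all add: orth_def l\<^sub>J u\<^sub>J)
  have orth_S: "(\<chi> l. orth (N $ l)) \<in> S" if "N \<in> S" for N
    using that by (simp add: S layer_space_iff orth_def supported_on_newton_schulz)
  have u0: "0 \<le> u\<^sub>J" using orth_norm[of 0] norm_ge_zero order_trans by blast
  have muon': "layerwise_muon S f orth \<beta>1 \<beta>2 \<gamma> T Xinit (\<lambda>t. \<xi> t \<omega>) (\<lambda>t. X t \<omega>) (\<lambda>t. Mom t \<omega>)"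
    if "\<omega> \<in> space \<Omega>" for \<omega> using muon that by (simp add: orth_def)
  have \<xi>_meas: "\<xi> t \<in> measurable \<Omega> P" and \<xi>_law: "distr \<Omega> P (\<xi> t) = P" if "t \<in> {1..T}" for t
    using sample that by auto
  have \<xi>_space: "\<xi> t \<omega> \<in> space P" if "t \<in> {1..T}" "\<omega> \<in> space \<Omega>" for t \<omega>
    using measurable_space[OF \<xi>_meas] that by blast
  have XS: "X (Suc t) \<omega> \<in> S" if "t \<le> T" "\<omega> \<in> space \<Omega>" for t \<omega>
    using muon_iterates_mem[OF muon'[OF that(2)] subS _ orth_S init that(1)]
      grad_on_mem[OF subS] f_differentiable \<xi>_space that(2) by blast
  then have XS': "X t \<omega> \<in> S" if "t \<in> {1..T + 1}" "\<omega> \<in> space \<Omega>" for t \<omega>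
    using that by (cases t) auto

  have grad_meas: "(\<lambda>(x, z). grad_on S (\<lambda>y. f y z) x) \<in> borel_measurable (restrict_space borel S \<Otimes>\<^sub>M P)"
    using f_integrable f_differentiable
    by (intro measurable_grad_on subS) (auto intro: borel_measurable_integrable)
  have gradF_meas: "grad_on S F \<in> borel_measurable (restrict_space borel S)"
    using continuous_on_grad_on[OF smooth smooth_const(2-4)]
    by (rule borel_measurable_continuous_on_restrict)
  have orth_meas: "orth \<in> borel_measurable borel"
    unfolding orth_def by (rule borel_measurable_newton_schulz)
  have space_H: "space (H t) = space \<Omega>" for t
    unfolding H_def by (rule space_sigma_history)
  have sets_H: "sets (H t) = history \<Omega> P \<xi> t" for t
    unfolding H_def by (rule sets_sigma_history)
  have H_mono: "sets (H t) \<subseteq> sets (H (Suc t))" for t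
    unfolding sets_H history_def by (intro sigma_sets_mono' UN_mono) auto
  have \<xi>_H: "\<xi> t \<in> measurable (H (Suc t)) P" if t: "t \<in> {1..T}" for t
  proof (rule measurableI)
    show "\<xi> t \<omega> \<in> space P" if "\<omega> \<in> space (H (Suc t))" for \<omega>
      using \<xi>_space t that by (simp add: space_H)
    show "\<xi> t -` A \<inter> space (H (Suc t)) \<in> sets (H (Suc t))" if "A \<in> sets P" for A
      unfolding sets_H history_def space_H using that t
      by (intro sigma_sets.Basic UN_I[of t]) (auto simp: sample_events_def)
  qed
  \<comment> \<open>That the history consists of events of the probability space is contained in the
    independence assumption, which is available for \<open>t\<close> up to \<open>T\<close>.\<close>
  have HM: "measurable (H t) N \<subseteq> measurable \<Omega> N" if t: "t \<in> {1..T}" for t and N :: "'x measure"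
  proof -
    have "history \<Omega> P \<xi> t \<subseteq> sets \<Omega>"
      using indep t by (auto simp: \<Omega>.indep_set_def \<Omega>.indep_sets_def split: bool.splits)
    then show ?thesis by (auto simp: measurable_def space_H sets_H)
  qed
  have adapted: "X t \<in> measurable (H t) (restrict_space borel S)"
      "(\<lambda>\<omega>. momentum_noise \<beta>1 (n \<omega>) (t - 1)) \<in> borel_measurable (H t)" if t: "t \<in> {1..T}" for t
  proof -
    have "t - 1 \<le> T" "Suc (t - 1) = t" using t by auto
    with muon_adapted[OF grad_meas gradF_meas orth_meas space_H H_mono \<xi>_H XS muon', of "t - 1"]
    show "X t \<in> measurable (H t) (restrict_space borel S)"
      "(\<lambda>\<omega>. momentum_noise \<beta>1 (n \<omega>) (t - 1)) \<in> borel_measurable (H t)"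
      by (simp_all add: n_def)
  qed
  have X_meas: "X t \<in> measurable \<Omega> (restrict_space borel S)" if t: "t \<in> {1..T}" for t
    using adapted(1)[OF t] HM[OF t] by blast
  have g_meas: "g t \<in> borel_measurable \<Omega>" if t: "t \<in> {1..T}" for t
    unfolding g_def using measurable_compose[OF X_meas[OF t] gradF_meas] .
  have n_meas: "(\<lambda>\<omega>. n \<omega> t) \<in> borel_measurable \<Omega>" if t: "t \<in> {1..T}" for t
  proof -
    have "(\<lambda>\<omega>. (X t \<omega>, \<xi> t \<omega>)) \<in> measurable \<Omega> (restrict_space borel S \<Otimes>\<^sub>M P)"
      using X_meas[OF t] \<xi>_meas[OF t] by (rule measurable_Pair)
    from measurable_compose[OF this grad_meas] g_meas[OF t] show ?thesis
      unfolding n_def g_def by simp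
  qed

  have noise: "integrable \<Omega> (\<lambda>\<omega>. (norm (n \<omega> t $ l))\<^sup>2)"
      "(LINT \<omega>|\<Omega>. (norm (n \<omega> t $ l))\<^sup>2) \<le> (\<sigma> l)\<^sup>2"
      "integrable \<Omega> (\<lambda>\<omega>. (norm (momentum_noise \<beta>1 (\<lambda>t. n \<omega> t $ l) (t - 1)))\<^sup>2) \<Longrightarrow>
       integrable \<Omega> (\<lambda>\<omega>. momentum_noise \<beta>1 (\<lambda>t. n \<omega> t $ l) (t - 1) \<bullet> n \<omega> t $ l) \<and>
       (LINT \<omega>|\<Omega>. momentum_noise \<beta>1 (\<lambda>t. n \<omega> t $ l) (t - 1) \<bullet> n \<omega> t $ l) = 0"
    if t: "t \<in> {1..T}" for t l
  proof -
    \<comment> \<open>The past is summarized by a pair: the current iterate, which determines the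
      law of the fresh noise, and the averaged earlier noise, whose pairing with it has to vanish.
      Accordingly \<open>h\<close> reads the first component and \<open>w\<close> the
      second.\<close>
    define h :: "(real ^ 'c ^ 'r ^ 'l) \<times> (real ^ 'c ^ 'r ^ 'l) \<Rightarrow> 'z \<Rightarrow> real ^ 'c ^ 'r" where
      "h y z = grad_on S (\<lambda>Y. f Y z) (fst y) $ l - grad_on S F (fst y) $ l" for y z
    define w :: "(real ^ 'c ^ 'r ^ 'l) \<times> (real ^ 'c ^ 'r ^ 'l) \<Rightarrow> real ^ 'c ^ 'r" where
      "w y = snd y $ l" for y
    define Y where "Y \<omega> = (X t \<omega>, momentum_noise \<beta>1 (n \<omega>) (t - 1))" for \<omega>
    let ?N = "restrict_space borel S \<Otimes>\<^sub>M (borel :: (real ^ 'c ^ 'r ^ 'l) measure)"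
    have YH: "Y \<in> measurable (H t) ?N"
      unfolding Y_def using adapted[OF t] by (rule measurable_Pair)
    then have YM: "Y \<in> measurable \<Omega> ?N" using HM[OF t] by blast
    have law: "distr \<Omega> (?N \<Otimes>\<^sub>M P) (\<lambda>\<omega>. (Y \<omega>, \<xi> t \<omega>)) = distr \<Omega> ?N Y \<Otimes>\<^sub>M P"
      using \<Omega>.indep_set_distr_pair[OF _ sigma_algebra_history YH[unfolded H_def] \<xi>_meas[OF t]]
        indep t \<xi>_law[OF t] by simp
    have "(\<lambda>p. (fst (fst p), snd p)) \<in> measurable (?N \<Otimes>\<^sub>M P) (restrict_space borel S \<Otimes>\<^sub>M P)"
      by measurable
    from measurable_compose[OF this grad_meas]
    have G: "(\<lambda>p. grad_on S (\<lambda>Y. f Y (snd p)) (fst (fst p))) \<in> borel_measurable (?N \<Otimes>\<^sub>M P)" by simp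
    have "(\<lambda>p. fst (fst p)) \<in> measurable (?N \<Otimes>\<^sub>M P) (restrict_space borel S)" by measurable
    from measurable_compose[OF this gradF_meas]
    have GF: "(\<lambda>p. grad_on S F (fst (fst p))) \<in> borel_measurable (?N \<Otimes>\<^sub>M P)" .
    have h: "(\<lambda>(y, z). h y z) \<in> borel_measurable (?N \<Otimes>\<^sub>M P)"
      unfolding h_def case_prod_beta using G GF by (intro borel_measurable_diff borel_measurable_vec_nth)
    have w: "w \<in> borel_measurable ?N" unfolding w_def by measurable
    have fstS: "fst y \<in> S" if "y \<in> space ?N" for y
      using that by (auto simp: space_pair_measure space_restrict_space)
    have mean: "integrable P (h y)" "(LINT z|P. h y z) = 0" if "y \<in> space ?N" for y
      using variance fstS[OF that] unfolding layerwise_variance_def h_def F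
      by (auto simp: P.prob_space)
    have sq: "integrable P (\<lambda>z. (norm (h y z))\<^sup>2)" "(LINT z|P. (norm (h y z))\<^sup>2) \<le> (\<sigma> l)\<^sup>2"
      if "y \<in> space ?N" for y
      using variance fstS[OF that] unfolding layerwise_variance_def h_def F by auto
    have hn: "h (Y \<omega>) (\<xi> t \<omega>) = n \<omega> t $ l" for \<omega> by (simp add: h_def Y_def n_def)
    have wn: "w (Y \<omega>) = momentum_noise \<beta>1 (\<lambda>t. n \<omega> t $ l) (t - 1)" for \<omega>
      by (simp add: w_def Y_def momentum_noise_nth)
    note * = \<Omega>.fresh_sample_noise[OF data YM \<xi>_meas[OF t] law h sq mean w]
    show "integrable \<Omega> (\<lambda>\<omega>. (norm (n \<omega> t $ l))\<^sup>2)" "(LINT \<omega>|\<Omega>. (norm (n \<omega> t $ l))\<^sup>2) \<le> (\<sigma> l)\<^sup>2"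
      "integrable \<Omega> (\<lambda>\<omega>. (norm (momentum_noise \<beta>1 (\<lambda>t. n \<omega> t $ l) (t - 1)))\<^sup>2) \<Longrightarrow>
       integrable \<Omega> (\<lambda>\<omega>. momentum_noise \<beta>1 (\<lambda>t. n \<omega> t $ l) (t - 1) \<bullet> n \<omega> t $ l) \<and>
       (LINT \<omega>|\<Omega>. momentum_noise \<beta>1 (\<lambda>t. n \<omega> t $ l) (t - 1) \<bullet> n \<omega> t $ l) = 0"
      using * by (simp_all only: hn wn)
  qed

  define W where "W t l \<omega> = norm (nesterov_noise \<beta>1 \<beta>2 (n \<omega>) t $ l)" for t l \<omega>
  have v0: "0 \<le> v\<^sub>\<beta>"
    using params mult_le_one[of \<beta>1 \<beta>2] by (auto simp: v\<^sub>\<beta> \<delta> intro!: add_nonneg_nonneg mult_nonneg_nonneg)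
  have W_int: "integrable \<Omega> (W t l)" and W_le: "(LINT \<omega>|\<Omega>. W t l \<omega>) \<le> v\<^sub>\<beta> * \<sigma> l"
    if t: "t \<in> {1..T}" for t l
  proof -
    have \<sigma>0: "0 \<le> \<sigma> l" using variance by (simp add: layerwise_variance_def)
    have "(\<lambda>\<omega>. momentum_noise \<beta>1 (n \<omega>) (t - 1)) \<in> borel_measurable \<Omega>"
      using adapted(2)[OF t] HM[OF t] by blast
    then have "(\<lambda>\<omega>. nesterov_noise \<beta>1 \<beta>2 (n \<omega>) t $ l) \<in> borel_measurable \<Omega>"
      unfolding nesterov_noise_def using n_meas[OF t] by (intro borel_measurable_vec_nth) simp
    then have meas: "(\<lambda>\<omega>. nesterov_noise \<beta>1 \<beta>2 (\<lambda>t. n \<omega> t $ l) t) \<in> borel_measurable \<Omega>"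
      by (simp only: nesterov_noise_nth)
    \<comment> \<open>Second moments are taken for one layer at a time and only first moments are
      added over the layers, so dependence between the noises of different layers does no
      harm.\<close>
    note moment = nesterov_noise_second_moment[where n = "\<lambda>t \<omega>. n \<omega> t $ l" and M = \<Omega>,
        OF noise params(1-4) t]
    have "0 \<le> v\<^sub>\<beta> * \<sigma> l" using v0 \<sigma>0 by simp
    moreover have "(LINT \<omega>|\<Omega>. (norm (nesterov_noise \<beta>1 \<beta>2 (\<lambda>t. n \<omega> t $ l) t))\<^sup>2) \<le> (v\<^sub>\<beta> * \<sigma> l)\<^sup>2"
      using moment(2) by (simp only: v\<^sub>\<beta> \<delta> mult.commute)
    ultimately show "integrable \<Omega> (W t l)" "(LINT \<omega>|\<Omega>. W t l \<omega>) \<le> v\<^sub>\<beta> * \<sigma> l"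
      unfolding W_def nesterov_noise_nth
      using \<Omega>.expectation_norm_le_of_second_moment[OF meas moment(1)] by auto
  qed

  have g_int: "integrable \<Omega> (\<lambda>\<omega>. norm (g t \<omega> $ l))" if t: "t \<in> {1..T}" for t l
  proof -
    \<comment> \<open>The local Lipschitz constant at the deterministic starting point;
      \<open>B\<close> bounds the distance reached after \<open>t - 1\<close> steps. Together they
      bound the gradient uniformly over all samples.\<close>
    define K where "K = L0 + (1 - q) * L1 + q * L1 * norm (grad_on S F Xinit)"
    define B where "B = real (t - 1) * (\<gamma> * (sqrt (real CARD('l)) * u\<^sub>J))"
    have K0: "0 \<le> K" using smooth_const by (simp add: K_def)
    have "norm (g t \<omega> $ l) \<le> norm (grad_on S F Xinit) + K * B" if \<omega>: "\<omega> \<in> space \<Omega>" for \<omega>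
    proof -
      have Xt: "X t \<omega> \<in> S" using XS'[OF _ \<omega>] t by simp
      have "t - 1 \<le> T" "Suc (t - 1) = t" using t by auto
      then have "norm (Xinit - X t \<omega>) \<le> B"
        using muon_iterates_bounded[OF muon'[OF \<omega>] _ orth_norm, of "t - 1"] params
        by (simp add: B_def norm_minus_commute)
      then have "norm (grad_on S F Xinit - g t \<omega>) \<le> K * B"
        using joint_smooth_on_affine[OF smooth smooth_const(2-4) init Xt] K0
        unfolding g_def K_def by (meson mult_left_mono order_trans)
      then have "norm (g t \<omega>) \<le> norm (grad_on S F Xinit) + K * B"
        using norm_triangle_sub[of "g t \<omega>" "grad_on S F Xinit"] by (simp add: norm_minus_commute)
      then show ?thesis using Finite_Cartesian_Product.norm_nth_le[of "g t \<omega>" l] by linarith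
    qed
    then show ?thesis
      using g_meas[OF t]
      by (intro \<Omega>.integrable_const_bound[where B = "norm (grad_on S F Xinit) + K * B"] AE_I2) auto
  qed

  \<comment> \<open>\<open>c1\<close> collects what is paid once and is later divided by
    \<open>T\<close>; \<open>c2\<close> is paid in every step.\<close>
  define c1 where "c1 = D / \<gamma> + \<beta>2 * (l\<^sub>J + u\<^sub>J) * G\<^sub>F / \<delta>"
  define c2 where "c2 = \<gamma> * \<beta>2 * L * u\<^sub>J * (l\<^sub>J + u\<^sub>J) * Lhat / \<delta> + \<gamma> * L * u\<^sub>J\<^sup>2 * Lhat / 2"
  have path: "\<Delta> * (\<Sum>t=1..T. \<Sum>l\<in>UNIV. norm (g t \<omega> $ l))
      \<le> c1 + (l\<^sub>J + u\<^sub>J) * (\<Sum>t=1..T. \<Sum>l\<in>UNIV. W t l \<omega>) + real T * c2" if \<omega>: "\<omega> \<in> space \<Omega>" for \<omega>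
    using muon_pathwise_bound[OF subS lower_bounded smooth_const smooth XS'[OF _ \<omega>]
        layerwise_muonD(2-4)[OF muon'[OF \<omega>]] params(1-5) orth_inner orth_norm]
      l\<^sub>J_pos layerwise_muonD(1)[OF muon'[OF \<omega>]]
    unfolding \<Delta> c1_def c2_def D G\<^sub>F L \<delta> Lhat g_def W_def n_def by simp
  have int_g: "integrable \<Omega> (\<lambda>\<omega>. \<Sum>t=1..T. \<Sum>l\<in>UNIV. norm (g t \<omega> $ l))"
    and int_W: "integrable \<Omega> (\<lambda>\<omega>. \<Sum>t=1..T. \<Sum>l\<in>UNIV. W t l \<omega>)"
    using g_int W_int by (auto intro!: Bochner_Integration.integrable_sum)
  have "\<Delta> * (\<Sum>t=1..T. \<Sum>l\<in>UNIV. LINT \<omega>|\<Omega>. norm (g t \<omega> $ l))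
      = (LINT \<omega>|\<Omega>. \<Delta> * (\<Sum>t=1..T. \<Sum>l\<in>UNIV. norm (g t \<omega> $ l)))"
    using g_int by (simp add: Bochner_Integration.integral_sum Bochner_Integration.integrable_sum)
  also have "\<dots> \<le> (LINT \<omega>|\<Omega>. c1 + (l\<^sub>J + u\<^sub>J) * (\<Sum>t=1..T. \<Sum>l\<in>UNIV. W t l \<omega>) + real T * c2)"
    using int_g int_W path by (intro integral_mono) auto
  also have "\<dots> = c1 + (l\<^sub>J + u\<^sub>J) * (\<Sum>t=1..T. \<Sum>l\<in>UNIV. LINT \<omega>|\<Omega>. W t l \<omega>) + real T * c2"
    using W_int int_W
    by (simp add: Bochner_Integration.integral_sum Bochner_Integration.integrable_sum \<Omega>.prob_space)
  also have "(\<Sum>t=1..T. \<Sum>l\<in>UNIV. LINT \<omega>|\<Omega>. W t l \<omega>) \<le> (\<Sum>t=1..T. \<Sum>l\<in>UNIV. v\<^sub>\<beta> * \<sigma> l)"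
    using W_le by (intro sum_mono) auto
  also have "\<dots> = real T * (v\<^sub>\<beta> * S\<^sub>F)" by (simp add: S\<^sub>F sum_distrib_left)
  finally have main: "\<Delta> * (\<Sum>t=1..T. \<Sum>l\<in>UNIV. LINT \<omega>|\<Omega>. norm (g t \<omega> $ l))
      \<le> c1 + (l\<^sub>J + u\<^sub>J) * (real T * (v\<^sub>\<beta> * S\<^sub>F)) + real T * c2"
    using l\<^sub>J_pos u0 by (simp add: mult_left_mono)
  have T: "0 < real T" using params by simp
  have "\<Delta> * (1 / real T * (\<Sum>t=1..T. \<Sum>l\<in>UNIV. LINT \<omega>|\<Omega>. norm (g t \<omega> $ l)))
      = \<Delta> * (\<Sum>t=1..T. \<Sum>l\<in>UNIV. LINT \<omega>|\<Omega>. norm (g t \<omega> $ l)) / real T" by simp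
  also have "\<dots> \<le> (c1 + (l\<^sub>J + u\<^sub>J) * (real T * (v\<^sub>\<beta> * S\<^sub>F)) + real T * c2) / real T"
    using main T by (intro divide_right_mono) auto
  also have "\<dots> = c1 / real T + (l\<^sub>J + u\<^sub>J) * v\<^sub>\<beta> * S\<^sub>F + c2"
    using T by (simp add: add_divide_distrib)
  also have "c1 / real T = D / (\<gamma> * real T) + \<beta>2 * (l\<^sub>J + u\<^sub>J) * G\<^sub>F / (real T * \<delta>)"
    by (simp add: c1_def add_divide_distrib mult.commute)
  finally show ?thesis by (simp add: g_def c2_def)
qed

end
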